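(* Let $M$ be a compact surface without boundary with $\chi(M)<0$, let $\mathfrak T$ be a topological triangulation of $M$, and let $x$ be a Delaunay angle system on $\mathfrak T$ such that $(\star)$ $\quad\sum_{e\in S}\theta^e(x)>\pi|S|$ for every nonempty set $S$ of triangles of $\mathfrak T$. Then $x$ is conformally equivalent to a unique uniform angle system.
   Context: An angle assignment $x$ on $\mathfrak T$ assigns a real number to each of the $3F$ angle slots (corners) of the $F$ triangles. For an edge $e$ shared by triangles $t_1,t_2$, with angles $A_i,B_i,C_i$ in $t_i$ and $A_i$ opposite to $e$, set $$\theta^e(x)=\frac{\pi+A_1-B_1-C_1}{2}+\frac{\pi+A_2-B_2-C_2}{2}.$$ $x$ is a Delaunay angle system if all angles are in $(0,\pi)$, the angles at each vertex sum to $2\pi$, and $\theta^e(x)\in(0,\pi)$ for each edge $e$. Two Delaunay angle systems $x,y$ are conformally equivalent if they are on the same triangulation and $\theta^e(x)=\theta^e(y)$ for every edge $e$. $\{e\in S\}$ is the set of edges belonging to at least one triangle in $S$, and $|S|$ is the number of triangles in $S$. The curvature of a triangle $t$ with angles $A,B,C$ is $k^t(x)=A+B+C-\pi$. If $k^t(x)<0$ there is a hyperbolic triangle (curvature $-1$), unique up to isometry, with these angles. A Delaunay angle system is uniform if $k^t(x)<0$ for all $t$ and these hyperbolic triangles fit together, i.e. for every edge $e$ the two hyperbolic triangles sharing $e$ assign the same length to $e$ (so that they glue to a hyperbolic structure on $M$). *)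

theory Defs
  imports "HOL-Homology.Homology" "HOL-Library.Numeral_Type"
begin

section \<open>Closed surfaces and their Euler characteristic\<close>

definition closed_surface :: "'a topology \<Rightarrow> bool" where
  "closed_surface M \<longleftrightarrow>
     compact_space M \<and> Hausdorff_space M \<and>
     (\<forall>p\<in>topspace M. \<exists>U. openin M U \<and> p \<in> U \<and>
        subtopology M U homeomorphic_space (euclidean :: (real ^ 2) topology))"

definition int_independent :: "('g, 'm) monoid_scheme \<Rightarrow> 'g set \<Rightarrow> bool" where
  "int_independent G B \<longleftrightarrow>
     (\<forall>c :: 'g \<Rightarrow> int. finprod G (\<lambda>b. b [^]\<^bsub>G\<^esub> c b) B = \<one>\<^bsub>G\<^esub> \<longrightarrow> (\<forall>b\<in>B. c b = 0))"

text \<open>The rank of an abelian group; only meaningful when it is finite.\<close>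

definition group_rank :: "('g, 'm) monoid_scheme \<Rightarrow> nat" where
  "group_rank G = Sup {card B | B. finite B \<and> B \<subseteq> carrier G \<and> int_independent G B}"

text \<open>For a closed surface the homology vanishes above dimension two, so the alternating sum
  of the Betti numbers stops there.\<close>

definition surface_euler_characteristic :: "'a topology \<Rightarrow> int" where
  "surface_euler_characteristic M =
     (\<Sum>p\<le>(2::nat). (-1) ^ p * int (group_rank (homology_group (int p) M)))"


section \<open>Topological triangulations\<close>

text \<open>The model triangle in barycentric coordinates. Its vertices, and the sides opposite to
  them, are indexed by the three-element type \<open>3\<close>.\<close>

definition model_triangle :: "(real ^ 3) set" where
  "model_triangle = {p. (\<forall>i. 0 \<le> p $ i) \<and> (\<Sum>i\<in>UNIV. p $ i) = 1}"

text \<open>The relatively open face spanned by the vertices in \<open>J\<close>.\<close>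

definition open_face :: "3 set \<Rightarrow> (real ^ 3) set" where
  "open_face J = {p \<in> model_triangle. {i. p $ i > 0} = J}"

text \<open>A triangulation with triangles labelled by \<open>'t\<close> is given by the characteristic maps
  \<open>\<phi> t\<close> of its triangles. As for the Delaunay triangulations of a hyperbolic surface, several
  vertices or sides of one triangle may be identified in \<open>M\<close>: only the open faces are embedded.\<close>

definition vertex :: "('t \<Rightarrow> real ^ 3 \<Rightarrow> 'a) \<Rightarrow> 't \<Rightarrow> 3 \<Rightarrow> 'a" where
  "vertex \<phi> t i = \<phi> t (axis i 1)"

definition edge :: "('t \<Rightarrow> real ^ 3 \<Rightarrow> 'a) \<Rightarrow> 't \<Rightarrow> 3 \<Rightarrow> 'a set" where
  "edge \<phi> t i = \<phi> t ` {p \<in> model_triangle. p $ i = 0}"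

definition edges_of :: "('t \<Rightarrow> real ^ 3 \<Rightarrow> 'a) \<Rightarrow> 't set \<Rightarrow> 'a set set" where
  "edges_of \<phi> S = {edge \<phi> t i | t i. t \<in> S}"

abbreviation edges :: "('t \<Rightarrow> real ^ 3 \<Rightarrow> 'a) \<Rightarrow> 'a set set" where
  "edges \<phi> \<equiv> edges_of \<phi> UNIV"

text \<open>The pairs \<open>(t, i)\<close> such that \<open>e\<close> is the side of \<open>t\<close> opposite to the corner \<open>i\<close>.\<close>

definition edge_slots :: "('t \<Rightarrow> real ^ 3 \<Rightarrow> 'a) \<Rightarrow> 'a set \<Rightarrow> ('t \<times> 3) set" where
  "edge_slots \<phi> e = {(t, i). edge \<phi> t i = e}"

definition vertex_slots :: "('t \<Rightarrow> real ^ 3 \<Rightarrow> 'a) \<Rightarrow> 'a \<Rightarrow> ('t \<times> 3) set" where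
  "vertex_slots \<phi> v = {(t, i). vertex \<phi> t i = v}"

text \<open>The third condition says that the open cells of \<open>M\<close> are disjoint or equal and have a
  well-defined dimension, and that distinct labels give distinct triangles. The last one holds
  for every such decomposition of a surface without boundary; when both sides belong to the same
  triangle, that triangle is glued to itself.\<close>

definition topological_triangulation :: "'a topology \<Rightarrow> ('t::finite \<Rightarrow> real ^ 3 \<Rightarrow> 'a) \<Rightarrow> bool" where
  "topological_triangulation M \<phi> \<longleftrightarrow>
     (\<forall>t. continuous_map (top_of_set model_triangle) M (\<phi> t)) \<and>
     (\<forall>t J. inj_on (\<phi> t) (open_face J)) \<and>
     (\<forall>t J t' J'. \<phi> t ` open_face J \<inter> \<phi> t' ` open_face J' \<noteq> {} \<longrightarrow>
        card J = card J' \<and> \<phi> t ` open_face J = \<phi> t' ` open_face J' \<and> (J = UNIV \<longrightarrow> t = t')) \<and>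
     (\<Union>t. \<phi> t ` model_triangle) = topspace M \<and>
     (\<forall>e\<in>edges \<phi>. card (edge_slots \<phi> e) = 2)"


section \<open>Angle systems\<close>

text \<open>In an angle assignment \<open>x\<close>, the number \<open>x t i\<close> is the angle of \<open>t\<close> at its vertex \<open>i\<close>,
  opposite to \<open>edge \<phi> t i\<close>.\<close>

definition theta :: "('t::finite \<Rightarrow> real ^ 3 \<Rightarrow> 'a) \<Rightarrow> ('t \<Rightarrow> 3 \<Rightarrow> real) \<Rightarrow> 'a set \<Rightarrow> real" where
  "theta \<phi> x e = (\<Sum>(t, i)\<in>edge_slots \<phi> e. (pi + x t i - (\<Sum>j\<in>-{i}. x t j)) / 2)"

definition delaunay :: "('t::finite \<Rightarrow> real ^ 3 \<Rightarrow> 'a) \<Rightarrow> ('t \<Rightarrow> 3 \<Rightarrow> real) \<Rightarrow> bool" where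
  "delaunay \<phi> x \<longleftrightarrow>
     (\<forall>t i. x t i \<in> {0<..<pi}) \<and>
     (\<forall>v\<in>{vertex \<phi> t i | t i. True}. (\<Sum>(t, i)\<in>vertex_slots \<phi> v. x t i) = 2 * pi) \<and>
     (\<forall>e\<in>edges \<phi>. theta \<phi> x e \<in> {0<..<pi})"

definition conformally_equivalent ::
    "('t::finite \<Rightarrow> real ^ 3 \<Rightarrow> 'a) \<Rightarrow> ('t \<Rightarrow> 3 \<Rightarrow> real) \<Rightarrow> ('t \<Rightarrow> 3 \<Rightarrow> real) \<Rightarrow> bool" where
  "conformally_equivalent \<phi> x y \<longleftrightarrow>
     delaunay \<phi> x \<and> delaunay \<phi> y \<and> (\<forall>e\<in>edges \<phi>. theta \<phi> x e = theta \<phi> y e)"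

definition curvature :: "('t \<Rightarrow> 3 \<Rightarrow> real) \<Rightarrow> 't \<Rightarrow> real" where
  "curvature x t = (\<Sum>i\<in>UNIV. x t i) - pi"


section \<open>Hyperbolic triangles\<close>

text \<open>The hyperbolic plane of curvature \<open>-1\<close> is the upper sheet of the hyperboloid in
  Minkowski space.\<close>

definition mink :: "real ^ 3 \<Rightarrow> real ^ 3 \<Rightarrow> real" where
  "mink p q = p $ 1 * q $ 1 + p $ 2 * q $ 2 - p $ 3 * q $ 3"

definition hyp_plane :: "(real ^ 3) set" where
  "hyp_plane = {p. mink p p = -1 \<and> p $ 3 > 0}"

definition hyp_dist :: "real ^ 3 \<Rightarrow> real ^ 3 \<Rightarrow> real" where
  "hyp_dist p q = arcosh (- mink p q)"

text \<open>The orthogonal projection of \<open>q\<close> to the tangent plane at \<open>p\<close>; for \<open>q\<close> in the hyperbolic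
  plane other than \<open>p\<close>, it is tangent to the geodesic ray from \<open>p\<close> through \<open>q\<close>.\<close>

definition hyp_direction :: "real ^ 3 \<Rightarrow> real ^ 3 \<Rightarrow> real ^ 3" where
  "hyp_direction p q = q + mink p q *\<^sub>R p"

definition hyp_angle :: "real ^ 3 \<Rightarrow> real ^ 3 \<Rightarrow> real ^ 3 \<Rightarrow> real" where
  "hyp_angle p q r =
     (let u = hyp_direction p q; v = hyp_direction p r
      in arccos (mink u v / (sqrt (mink u u) * sqrt (mink v v))))"

text \<open>Geodesics are the intersections of the hyperboloid with planes through the origin, so
  three distinct points form a nondegenerate triangle iff they are linearly independent.\<close>

definition hyp_triangle :: "(3 \<Rightarrow> real ^ 3) \<Rightarrow> bool" where
  "hyp_triangle P \<longleftrightarrow> range P \<subseteq> hyp_plane \<and> inj P \<and> independent (range P)"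

text \<open>Arithmetic in the type \<open>3\<close> is modulo three, so \<open>i + 1\<close> and \<open>i + 2\<close> are the two
  indices other than \<open>i\<close>.\<close>

definition corner_angle :: "(3 \<Rightarrow> real ^ 3) \<Rightarrow> 3 \<Rightarrow> real" where
  "corner_angle P i = hyp_angle (P i) (P (i + 1)) (P (i + 2))"

definition side_length :: "(3 \<Rightarrow> real ^ 3) \<Rightarrow> 3 \<Rightarrow> real" where
  "side_length P i = hyp_dist (P (i + 1)) (P (i + 2))"

text \<open>The triangles \<open>P t\<close> are determined by \<open>x\<close> up to isometry, hence so are their side lengths.\<close>

definition uniform :: "('t::finite \<Rightarrow> real ^ 3 \<Rightarrow> 'a) \<Rightarrow> ('t \<Rightarrow> 3 \<Rightarrow> real) \<Rightarrow> bool" where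
  "uniform \<phi> x \<longleftrightarrow>
     delaunay \<phi> x \<and> (\<forall>t. curvature x t < 0) \<and>
     (\<exists>P. (\<forall>t. hyp_triangle (P t) \<and> (\<forall>i. corner_angle (P t) i = x t i)) \<and>
          (\<forall>t i t' i'. edge \<phi> t i = edge \<phi> t' i' \<longrightarrow>
             side_length (P t) i = side_length (P t') i'))"

end

theory Submission
  imports Defs "HOL-Analysis.Cartesian_Euclidean_Space"
begin

text \<open>A uniform Delaunay angle system has all its triangles inscribed in circles, so it is a hyperbolic
  circle pattern with intersection angles \<open>theta\<close>. For an edge \<open>e\<close> with sides \<open>(t, i)\<close>, \<open>(t', i')\<close> put
  \<open>\<psi> = (\<pi> + A - B - C) / 2\<close>, so that \<open>theta e = \<psi> + \<psi>'\<close>. The length \<open>l\<close> of the side satisfies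
  \<open>tanh (l / 2) = K sin \<psi>\<close>, where \<open>K\<close> depends only on the triangle and is \<open>tanh\<close> of its circumradius.
  Hence in a uniform system \<open>\<psi>\<close> is determined by \<open>theta e\<close> and \<open>K / K'\<close>, the triangle with the largest
  \<open>K\<close> has all \<open>\<psi> < \<pi> / 2\<close> and therefore \<open>K < 1\<close>, and what remains to be solved is that the angles
  at the centre of every circle add up to \<open>2 \<pi>\<close>.

  The centre angle over a side increases with the radius of the neighbouring circle, and the sum of
  the two centre angles over an edge strictly decreases in both radii. Existence follows by Perron's
  method: among the radii with all cone angles at most \<open>2 \<pi>\<close> there are smallest ones, and
  condition \<open>(\<star>)\<close> is exactly what keeps the radii of a set \<open>S\<close> of triangles from shrinking to zero.
  Uniqueness follows by comparing two solutions with their minimum. The cone angles at the vertices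
  are functions of \<open>theta\<close>, so they need no attention.\<close>

section \<open>The inverse cotangent\<close>

text \<open>This branch is continuous through zero and covers obtuse angles as well.\<close>

definition acot :: "real \<Rightarrow> real" where
  "acot z = pi / 2 - arctan z"

lemma acot_bounds: "0 < acot z" "acot z < pi"
  using arctan_bounded[of z] by (auto simp: acot_def)

lemma cot_acot [simp]: "cot (acot z) = z"
proof -
  have "cot (acot z) = tan (pi/2 - acot z)"
    by (simp add: tan_def cot_def cos_diff sin_diff)
  then show ?thesis by (simp add: acot_def tan_arctan)
qed

lemma acot_cot: "0 < x \<Longrightarrow> x < pi \<Longrightarrow> acot (cot x) = x"
proof -
  assume x: "0 < x" "x < pi"
  have "cot x = tan (pi/2 - x)"
    by (simp add: tan_def cot_def cos_diff sin_diff)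
  moreover have "arctan (tan (pi/2 - x)) = pi/2 - x"
    using x by (intro arctan_tan) auto
  ultimately show ?thesis by (simp add: acot_def)
qed

lemma acot_le_iff [simp]: "acot a \<le> acot b \<longleftrightarrow> b \<le> a"
  by (simp add: acot_def arctan_le_iff)

lemma tendsto_acot: "(f \<longlongrightarrow> l) F \<Longrightarrow> ((\<lambda>x. acot (f x)) \<longlongrightarrow> acot l) F"
  unfolding acot_def by (intro tendsto_intros)

lemma cot_add_eq:
  fixes x y :: real
  assumes "sin x \<noteq> 0" "sin y \<noteq> 0"
  shows "sin (x + y) = sin x * sin y * (cot x + cot y)"
  using assms by (simp add: cot_def sin_add field_simps)

lemma sin_add3_cot:
  fixes x y z :: real
  assumes "sin x \<noteq> 0" "sin y \<noteq> 0" "sin z \<noteq> 0"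
  shows "sin (x + y + z) = sin x * sin y * sin z * (cot x * cot y + cot y * cot z + cot z * cot x - 1)"
  using assms by (simp add: cot_def sin_add cos_add field_simps)

section \<open>Angles at the circumcentres\<close>

text \<open>Let two triangles with circumradii \<open>R\<close>, \<open>R'\<close> share an edge \<open>e\<close> with \<open>theta\<close>-value \<open>\<theta>\<close>, and put
  \<open>T = tanh (R / 2)\<close>, \<open>T' = tanh (R' / 2)\<close>. The circumcentres and an endpoint of \<open>e\<close> span a triangle
  with sides \<open>R\<close>, \<open>R'\<close> that enclose the angle \<open>\<pi> - \<theta>\<close>, and \<open>centre_angle \<theta> T T'\<close> is its angle at
  the first circumcentre. \<open>base_cot \<theta> T T'\<close> is the tangent of the base angle over \<open>e\<close> of the isosceles
  triangle spanned by \<open>e\<close> and the first circumcentre.\<close>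

definition base_cot :: "real \<Rightarrow> real \<Rightarrow> real \<Rightarrow> real" where
  "base_cot \<theta> T T' = (T * (1 + T'\<^sup>2) / (T' * (1 + T\<^sup>2)) + cos \<theta>) / sin \<theta>"

definition centre_angle :: "real \<Rightarrow> real \<Rightarrow> real \<Rightarrow> real" where
  "centre_angle \<theta> T T' = acot ((1 + T\<^sup>2) / (1 - T\<^sup>2) * base_cot \<theta> T T')"

text \<open>The quotient \<open>(1 + z\<^sup>2) / z\<close> decreases for z in (0, 1], because
  \<open>(1 + U\<^sup>2) * V - (1 + V\<^sup>2) * U\<close> factors as
  \<open>(V - U) * (1 - U * V)\<close>.\<close>

lemma base_cot_antimono:
  assumes "0 \<le> T" "0 < U" "U \<le> V" "V \<le> 1" "0 < sin \<theta>"
  shows "base_cot \<theta> T V \<le> base_cot \<theta> T U"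
proof -
  have "0 \<le> (V - U) * (1 - U * V)"
    using assms by (intro mult_nonneg_nonneg) (auto simp: mult_le_one)
  then have "(1 + V\<^sup>2) * U \<le> (1 + U\<^sup>2) * V"
    by (simp add: algebra_simps power2_eq_square)
  then have "(1 + V\<^sup>2) / V \<le> (1 + U\<^sup>2) / U"
    using assms by (simp add: divide_simps)
  then have "T / (1 + T\<^sup>2) * ((1 + V\<^sup>2) / V) \<le> T / (1 + T\<^sup>2) * ((1 + U\<^sup>2) / U)"
    using assms by (intro mult_left_mono) auto
  then have "T * (1 + V\<^sup>2) / (V * (1 + T\<^sup>2)) \<le> T * (1 + U\<^sup>2) / (U * (1 + T\<^sup>2))"
    by (simp add: mult.commute)
  then show ?thesis
    using assms by (simp add: base_cot_def divide_right_mono)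
qed

lemma centre_angle_mono:
  assumes "0 \<le> T" "T < 1" "0 < U" "U \<le> V" "V \<le> 1" "0 < sin \<theta>"
  shows "centre_angle \<theta> T U \<le> centre_angle \<theta> T V"
proof -
  have "T\<^sup>2 < 1" using assms by (simp add: power_less_one_iff)
  then show ?thesis
    using base_cot_antimono[of T U V \<theta>] assms
    unfolding centre_angle_def acot_le_iff by (intro mult_left_mono) auto
qed

text \<open>The two summands are half the sum and half the difference of the two centre angles, as given
  by Napier's analogies.\<close>

lemma centre_angle_napier:
  assumes "0 < T" "T < 1" "0 < T'" "T' < 1" "0 < \<theta>" "\<theta> < pi"
  shows "centre_angle \<theta> T T' =
    arctan (tan (\<theta>/2) * ((1 - T * T') / (1 + T * T'))) + arctan (tan (\<theta>/2) * ((T' - T) / (T' + T)))"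
proof -
  define \<tau> where "\<tau> = tan (\<theta>/2)"
  have \<tau>: "0 < \<tau>" using assms by (auto simp: \<tau>_def intro!: tan_gt_zero)
  have TT: "T * T' < 1" "T\<^sup>2 < 1"
    using mult_strict_mono[of T 1 T' 1] assms by (auto simp: power_less_one_iff)
  define u where "u = \<tau> * ((1 - T * T') / (1 + T * T'))"
  define v where "v = \<tau> * ((T' - T) / (T' + T))"
  have pos: "0 < T * T'" "0 < T + T'" "0 < 1 + T * T'" using assms by (auto intro: add_pos_pos)
  have u: "0 < u" unfolding u_def using TT pos \<tau> by simp
  have uv: "u + v = \<tau> * (2 * T' * (1 - T\<^sup>2)) / ((1 + T * T') * (T' + T))"
    unfolding u_def v_def using pos by (simp add: divide_simps) (simp add: algebra_simps power2_eq_square)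
  \<comment> \<open>Positivity of \<open>u + v\<close> puts the sum of the arctangents into the
    interval on which \<open>acot\<close> inverts \<open>cot\<close>, so it suffices to compare
    cotangents.\<close>
  have uv_pos: "0 < u + v" unfolding uv using assms TT \<tau> pos by simp
  have "- arctan v < arctan u" using uv_pos by (simp add: arctan_less_iff flip: arctan_minus)
  then have range: "0 < arctan u + arctan v" "arctan u + arctan v < pi"
    using arctan_bounded[of u] arctan_bounded[of v] by auto
  have c: "cos \<theta> = (1 - \<tau>\<^sup>2) / (1 + \<tau>\<^sup>2)" "sin \<theta> = 2 * \<tau> / (1 + \<tau>\<^sup>2)"
  proof -
    have "cos (\<theta>/2) > 0" using assms by (intro cos_gt_zero) auto
    then have n: "1 + \<tau>\<^sup>2 = 1 / (cos (\<theta>/2))\<^sup>2"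
      by (simp add: \<tau>_def tan_def field_simps)
    have m: "1 - \<tau>\<^sup>2 = cos \<theta> / (cos (\<theta>/2))\<^sup>2" "2 * \<tau> = sin \<theta> / (cos (\<theta>/2))\<^sup>2"
      using cos_double[of "\<theta>/2"] sin_double[of "\<theta>/2"] \<open>cos (\<theta>/2) > 0\<close>
      by (simp_all add: \<tau>_def tan_def power_divide diff_divide_distrib) (simp add: power2_eq_square)
    show "cos \<theta> = (1 - \<tau>\<^sup>2) / (1 + \<tau>\<^sup>2)" "sin \<theta> = 2 * \<tau> / (1 + \<tau>\<^sup>2)"
      unfolding n m using \<open>cos (\<theta>/2) > 0\<close> by simp_all
  qed
  have "cot (arctan u + arctan v) = (1 - u * v) / (u + v)"
  proof -
    have cu: "cos (arctan u) \<noteq> 0" "cos (arctan v) \<noteq> 0" by auto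
    have "u = sin (arctan u) / cos (arctan u)" "v = sin (arctan v) / cos (arctan v)"
      using tan_arctan[of u] tan_arctan[of v] by (simp_all add: tan_def)
    then have s: "sin (arctan u) = u * cos (arctan u)" "sin (arctan v) = v * cos (arctan v)"
      using cu by (simp_all add: field_simps)
    have "cot (arctan u + arctan v) =
        ((1 - u * v) * (cos (arctan u) * cos (arctan v))) / ((u + v) * (cos (arctan u) * cos (arctan v)))"
      unfolding cot_def cos_add sin_add s by (simp add: algebra_simps)
    then show ?thesis using cu by simp
  qed
  also have "\<dots> = (1 + T\<^sup>2) / (1 - T\<^sup>2) * base_cot \<theta> T T'"
  proof -
    have p: "1 + T\<^sup>2 > 0" "1 + \<tau>\<^sup>2 > 0" by (auto intro: add_pos_nonneg)
    have "1 - u * v = ((1 + T * T') * (T' + T) - \<tau>\<^sup>2 * ((1 - T * T') * (T' - T))) / ((1 + T * T') * (T' + T))"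
      unfolding u_def v_def using pos by (simp add: divide_simps) (simp add: algebra_simps power2_eq_square)
    then have "(1 - u * v) / (u + v) = ((1 + T * T') * (T' + T) - \<tau>\<^sup>2 * ((1 - T * T') * (T' - T))) / (\<tau> * (2 * T' * (1 - T\<^sup>2)))"
      unfolding uv using pos by simp
    also have "(1 + T * T') * (T' + T) - \<tau>\<^sup>2 * ((1 - T * T') * (T' - T))
        = T' * (1 + T\<^sup>2) * (1 - \<tau>\<^sup>2) + T * (1 + T'\<^sup>2) * (1 + \<tau>\<^sup>2)"
      by (simp add: algebra_simps power2_eq_square)
    finally have l: "(1 - u * v) / (u + v) = (T' * (1 + T\<^sup>2) * (1 - \<tau>\<^sup>2) + T * (1 + T'\<^sup>2) * (1 + \<tau>\<^sup>2)) / (\<tau> * (2 * T' * (1 - T\<^sup>2)))" .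
    have "base_cot \<theta> T T' = (T * (1 + T'\<^sup>2) * (1 + \<tau>\<^sup>2) + T' * (1 + T\<^sup>2) * (1 - \<tau>\<^sup>2)) / (2 * \<tau> * T' * (1 + T\<^sup>2))"
      unfolding base_cot_def c using p \<tau> assms by (simp add: divide_simps)
    then show ?thesis unfolding l using p \<tau> TT assms by (simp add: divide_simps) (simp add: algebra_simps)
  qed
  finally have "acot (cot (arctan u + arctan v)) = centre_angle \<theta> T T'"
    by (simp add: centre_angle_def)
  then show ?thesis using acot_cot[OF range] by (simp add: u_def v_def \<tau>_def)
qed

text \<open>Exchanging the two circles changes the sign of the half difference in
  \<open>centre_angle_napier\<close> and keeps the half sum, so only the latter survives.\<close>

lemma centre_angle_add:
  assumes "0 < T" "T < 1" "0 < T'" "T' < 1" "0 < \<theta>" "\<theta> < pi"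
  shows "centre_angle \<theta> T T' + centre_angle \<theta> T' T
    = 2 * arctan (tan (\<theta>/2) * ((1 - T * T') / (1 + T * T')))"
proof -
  have "tan (\<theta>/2) * ((T - T') / (T + T')) = - (tan (\<theta>/2) * ((T' - T) / (T' + T)))"
    by (simp add: algebra_simps diff_divide_distrib)
  then have "arctan (tan (\<theta>/2) * ((T - T') / (T + T'))) = - arctan (tan (\<theta>/2) * ((T' - T) / (T' + T)))"
    by (simp only: arctan_minus)
  then show ?thesis
    using centre_angle_napier[of T T' \<theta>] centre_angle_napier[of T' T \<theta>] assms
    by (simp add: mult.commute)
qed

lemma centre_angle_zero: "0 < T' \<Longrightarrow> 0 < \<theta> \<Longrightarrow> \<theta> < pi \<Longrightarrow> centre_angle \<theta> 0 T' = \<theta>"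
  using acot_cot[of \<theta>] by (simp add: centre_angle_def base_cot_def cot_def)

text \<open>The first radius may vanish in the limit, the second may not: if both vanish, the ratio
  inside \<open>base_cot\<close> has no determined limit.\<close>

lemma tendsto_centre_angle:
  assumes "(f \<longlongrightarrow> T) F" "(g \<longlongrightarrow> T') F" "0 \<le> T" "T < 1" "0 < T'" "0 < sin \<theta>"
  shows "((\<lambda>n. centre_angle \<theta> (f n) (g n)) \<longlongrightarrow> centre_angle \<theta> T T') F"
proof -
  have "1 - T\<^sup>2 \<noteq> 0" "1 + T\<^sup>2 > 0" using assms power_less_one_iff[of T 2] by (auto intro: add_pos_nonneg)
  then show ?thesis
    unfolding centre_angle_def base_cot_def using assms
    by (intro tendsto_acot tendsto_intros) auto
qed

section \<open>Circle patterns with prescribed intersection angles\<close>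

lemma tendsto_arctan_half:
  "((\<lambda>c. arctan (\<tau> * ((1 - c * c) / (1 + c * c)))) \<longlongrightarrow> 0) (at_left (1::real))"
proof -
  have "((\<lambda>c. arctan (\<tau> * ((1 - c * c) / (1 + c * c)))) \<longlongrightarrow> arctan (\<tau> * ((1 - 1 * 1) / (1 + 1 * 1)))) (at_left (1::real))"
    by (intro tendsto_intros) auto
  then show ?thesis by simp
qed

text \<open>A slot \<open>(t, i)\<close> stands for the side of the triangle \<open>t\<close> opposite to its corner \<open>i\<close>, and
  \<open>opp s\<close> is the slot to which \<open>s\<close> is glued.\<close>

locale edge_gluing =
  fixes opp :: "'t::finite \<times> 3 \<Rightarrow> 't \<times> 3"
    and \<theta> :: "'t \<times> 3 \<Rightarrow> real"
  assumes opp_opp [simp]: "opp (opp s) = s"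
    and theta_opp [simp]: "\<theta> (opp s) = \<theta> s"
    and theta_pos: "0 < \<theta> s"
    and theta_less_pi: "\<theta> s < pi"
begin

lemma sin_theta_pos: "0 < sin (\<theta> s)"
  using theta_pos theta_less_pi by (rule sin_gt_zero)

lemma tan_half_theta_pos: "0 < tan (\<theta> s / 2)"
  using theta_pos[of s] theta_less_pi[of s] by (intro tan_gt_zero) auto

definition slot_angle :: "('t \<Rightarrow> real) \<Rightarrow> 't \<times> 3 \<Rightarrow> real" where
  "slot_angle T s = centre_angle (\<theta> s) (T (fst s)) (T (fst (opp s)))"

text \<open>By reflection symmetry a side subtends twice its \<open>slot_angle\<close> at the
  circumcentre. A total angle of 2 \<pi> therefore means the value \<open>pi\<close>.\<close>

definition half_cone :: "('t \<Rightarrow> real) \<Rightarrow> 't \<Rightarrow> real" where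
  "half_cone T t = (\<Sum>i\<in>UNIV. slot_angle T (t, i))"

lemma sum_half_cone: "(\<Sum>t\<in>S. half_cone T t) = (\<Sum>s\<in>S \<times> UNIV. slot_angle T s)"
  by (simp add: half_cone_def sum.cartesian_product)

section \<open>Comparing the two centre angles over an edge\<close>

text \<open>The involution \<open>opp\<close> permutes the slots of \<open>S\<close> whose partner
  also lies in \<open>S\<close>, so there each term may be averaged with its partner.\<close>

lemma sum_symmetrize:
  fixes f :: "'t \<times> 3 \<Rightarrow> real"
  shows "(\<Sum>s\<in>S \<times> UNIV. f s) =
    (\<Sum>s\<in>S \<times> UNIV. if fst (opp s) \<in> S then (f s + f (opp s)) / 2 else f s)"
proof -
  define Q where "Q = (S \<times> UNIV) \<inter> {s. fst (opp s) \<in> S}"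
  have "(\<Sum>s\<in>Q. f (opp s)) = (\<Sum>s\<in>Q. f s)"
    by (rule sum.reindex_bij_witness[of _ opp opp]) (auto simp: Q_def mem_Times_iff)
  then have "(\<Sum>s\<in>Q. (f s + f (opp s)) / 2) = (\<Sum>s\<in>Q. f s)"
    by (simp add: sum.distrib flip: sum_divide_distrib)
  then show ?thesis
    using sum.If_cases[of "S \<times> UNIV" "\<lambda>s. fst (opp s) \<in> S" f f]
    by (simp add: sum.If_cases Q_def)
qed

lemma slot_angle_add:
  assumes "\<And>t. 0 < T t" "\<And>t. T t < 1"
  shows "slot_angle T s + slot_angle T (opp s) =
    2 * arctan (tan (\<theta> s / 2) * ((1 - T (fst s) * T (fst (opp s))) / (1 + T (fst s) * T (fst (opp s)))))"
  using centre_angle_add[of "T (fst s)" "T (fst (opp s))" "\<theta> s"] assms theta_pos theta_less_pi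
  by (simp add: slot_angle_def)

text \<open>Only the product \<open>a\<close> of the two parameters enters the sum, through the
  decreasing function \<open>(1 - a) / (1 + a)\<close>.\<close>

lemma slot_angle_add_less:
  assumes "\<And>t. 0 < U t" "\<And>t. U t \<le> T t" "\<And>t. T t < 1" "U (fst s) < T (fst s)"
  shows "slot_angle T s + slot_angle T (opp s) < slot_angle U s + slot_angle U (opp s)"
proof -
  let ?a = "T (fst s) * T (fst (opp s))" and ?b = "U (fst s) * U (fst (opp s))"
  have T: "0 < T t" and U: "U t < 1" for t
    using assms(1,2)[of t] assms(3)[of t] by linarith+
  have ab: "?b < ?a" by (intro mult_less_le_imp_less) (auto simp: assms T less_imp_le)
  have b: "0 < ?b" using assms by simp
  have "(1 - ?a) / (1 + ?a) < (1 - ?b) / (1 + ?b)"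
    using ab b by (simp add: divide_simps) (simp add: algebra_simps)
  then have "tan (\<theta> s / 2) * ((1 - ?a) / (1 + ?a)) < tan (\<theta> s / 2) * ((1 - ?b) / (1 + ?b))"
    using tan_half_theta_pos by (rule mult_strict_left_mono)
  then show ?thesis
    using slot_angle_add[of T s] slot_angle_add[of U s] T U assms
    by (simp add: arctan_less_iff del: times_divide_eq_right)
qed

lemma slot_angle_add_le:
  assumes "\<And>t. 0 < U t" "\<And>t. U t \<le> T t" "\<And>t. T t < 1"
  shows "slot_angle T s + slot_angle T (opp s) \<le> slot_angle U s + slot_angle U (opp s)"
proof (cases "U (fst s) = T (fst s) \<and> U (fst (opp s)) = T (fst (opp s))")
  case True
  then show ?thesis by (simp add: slot_angle_def)
next
  case False
  then have "U (fst s) < T (fst s) \<or> U (fst (opp s)) < T (fst (opp s))"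
    using assms(2)[of "fst s"] assms(2)[of "fst (opp s)"] by linarith
  then show ?thesis
    using slot_angle_add_less[of U T s] slot_angle_add_less[of U T "opp s"] assms by (auto simp: add.commute)
qed

lemma slot_angle_mono:
  assumes "\<And>t. 0 < U t" "\<And>t. U t \<le> T t" "\<And>t. T t < 1" "U (fst s) = T (fst s)"
  shows "slot_angle U s \<le> slot_angle T s"
  unfolding slot_angle_def assms(4)
  using assms(1,2,3)[of "fst s"] assms(1,2,3)[of "fst (opp s)"] assms(4) sin_theta_pos
  by (intro centre_angle_mono) auto

text \<open>For Perron's method: lowering radii elsewhere cannot spoil the cone condition at a
  triangle that keeps its own radius.\<close>

lemma half_cone_mono:
  assumes "\<And>t. 0 < U t" "\<And>t. U t \<le> T t" "\<And>t. T t < 1" "U t = T t"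
  shows "half_cone U t \<le> half_cone T t"
  unfolding half_cone_def using assms by (intro sum_mono slot_angle_mono) auto

section \<open>Uniqueness of the radii\<close>

text \<open>The minimum of two solutions is a supersolution, but its total cone angle is larger than that
  of the solutions because the sum of two centre angles over an edge is strictly decreasing.\<close>

lemma half_cone_solution_le:
  assumes T: "\<And>t. 0 < T t" "\<And>t. T t < 1" "\<And>t. half_cone T t = pi"
    and U: "\<And>t. 0 < U t" "\<And>t. U t < 1" "\<And>t. half_cone U t = pi"
  shows "T t \<le> U t"
proof (rule ccontr)
  assume "\<not> T t \<le> U t"
  define m where "m t = min (T t) (U t)" for t
  have m: "0 < m t" "m t < 1" "m t \<le> T t" "m t \<le> U t" for t
    using T U by (auto simp: m_def min_less_iff_disj)
  \<comment> \<open>At each triangle \<open>m\<close> agrees with one of the two solutions and lies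
    below it elsewhere.\<close>
  have "half_cone m t \<le> pi" for t
    using half_cone_mono[of m T t] half_cone_mono[of m U t] T U m by (cases "T t \<le> U t") (auto simp: m_def)
  then have "(\<Sum>t\<in>UNIV. half_cone m t) \<le> (\<Sum>t\<in>UNIV. half_cone T t)"
    by (intro sum_mono) (simp add: T)
  then have "(\<Sum>s\<in>UNIV. slot_angle m s) \<le> (\<Sum>s\<in>UNIV. slot_angle T s)"
    by (simp add: sum_half_cone)
  also have "\<dots> < (\<Sum>s\<in>UNIV. slot_angle m s)"
  proof -
    have "(\<Sum>s\<in>UNIV. slot_angle T s + slot_angle T (opp s)) < (\<Sum>s\<in>UNIV. slot_angle m s + slot_angle m (opp s))"
    proof (rule sum_strict_mono_ex1)
      \<comment> \<open>Any corner would do: \<open>m t < T t\<close> makes the inequality strict at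
        every slot of \<open>t\<close>.\<close>
      have "slot_angle T (t, 1) + slot_angle T (opp (t, 1)) < slot_angle m (t, 1) + slot_angle m (opp (t, 1))"
        using \<open>\<not> T t \<le> U t\<close> m T by (intro slot_angle_add_less) (auto simp: m_def)
      then show "\<exists>s\<in>UNIV. slot_angle T s + slot_angle T (opp s) < slot_angle m s + slot_angle m (opp s)"
        by blast
    qed (auto intro!: slot_angle_add_le m T)
    then show ?thesis
      using sum_symmetrize[of "slot_angle T" UNIV] sum_symmetrize[of "slot_angle m" UNIV]
      by (simp flip: sum_divide_distrib)
  qed
  finally show False by simp
qed

lemma half_cone_solution_unique:
  assumes "\<And>t. 0 < T t" "\<And>t. T t < 1" "\<And>t. half_cone T t = pi"
    and "\<And>t. 0 < U t" "\<And>t. U t < 1" "\<And>t. half_cone U t = pi"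
  shows "T = U"
  using half_cone_solution_le[of T U] half_cone_solution_le[of U T] assms by (intro ext antisym) auto

section \<open>Existence of the radii\<close>

text \<open>For equal radii \<open>centre_angle_add\<close> makes each centre angle a single
  arctangent, which tends to 0 as \<open>c\<close> tends to 1. Three angles of at most \<pi>/3 meet
  the bound.\<close>

lemma exists_equal_supersolution:
  obtains c where "0 < c" "c < 1" "\<And>t. half_cone (\<lambda>_. c) t \<le> pi"
proof -
  have "\<forall>\<^sub>F c in at_left 1. arctan (tan (\<theta> s / 2) * ((1 - c * c) / (1 + c * c))) < pi / 3" for s
    by (rule order_tendstoD[OF tendsto_arctan_half]) simp
  then have "\<forall>\<^sub>F c in at_left 1. \<forall>s. arctan (tan (\<theta> s / 2) * ((1 - c * c) / (1 + c * c))) < pi / 3"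
    by (rule eventually_all_finite)
  moreover have "\<forall>\<^sub>F c in at_left (1::real). c \<in> {0<..<1}"
    by (rule eventually_at_leftI[of 0]) auto
  ultimately have "\<forall>\<^sub>F c in at_left (1::real). c \<in> {0<..<1} \<and>
      (\<forall>s. arctan (tan (\<theta> s / 2) * ((1 - c * c) / (1 + c * c))) < pi / 3)"
    by eventually_elim auto
  then obtain c where c: "0 < c" "c < 1"
      "\<And>s. arctan (tan (\<theta> s / 2) * ((1 - c * c) / (1 + c * c))) < pi / 3"
    using eventually_happens'[OF trivial_limit_at_left_real] by (metis (no_types, lifting) greaterThanLessThan_iff)
  have "slot_angle (\<lambda>_. c) s \<le> pi / 3" for s
    using centre_angle_add[of c c "\<theta> s"] c(1,2) c(3)[of s] theta_pos theta_less_pi by (simp add: slot_angle_def)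
  then have "half_cone (\<lambda>_. c) t \<le> pi" for t
    using sum_bounded_above[of "UNIV :: 3 set" "\<lambda>i. slot_angle (\<lambda>_. c) (t, i)" "pi / 3"] by (simp add: half_cone_def)
  then show ?thesis using that c by blast
qed

lemma tendsto_half_cone:
  assumes "\<And>t. ((\<lambda>n. f n t) \<longlongrightarrow> T t) F" "\<And>t. 0 < T t" "\<And>t. T t < 1"
  shows "((\<lambda>n. half_cone (f n) t) \<longlongrightarrow> half_cone T t) F"
  unfolding half_cone_def slot_angle_def
  by (intro tendsto_sum tendsto_centre_angle assms less_imp_le sin_theta_pos)

text \<open>As the radii of the triangles in \<open>S\<close> shrink to zero, an edge between two of them becomes
  Euclidean, and an edge between one of them and another triangle contributes its full angle.\<close>

lemma tendsto_slot_angle_degenerate: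
  assumes f: "\<And>n t. 0 < f n t" "\<And>n t. f n t < 1"
    and lim: "\<And>t. (\<lambda>n. f n t) \<longlonglongrightarrow> T t"
    and T: "\<And>t. t \<in> S \<Longrightarrow> T t = 0" "\<And>t. t \<notin> S \<Longrightarrow> 0 < T t"
  shows "(\<lambda>n. \<Sum>s\<in>S \<times> UNIV. slot_angle (f n) s) \<longlonglongrightarrow>
    (\<Sum>s\<in>S \<times> UNIV. if fst (opp s) \<in> S then \<theta> s / 2 else \<theta> s)"
proof -
  have "(\<lambda>n. if fst (opp s) \<in> S then (slot_angle (f n) s + slot_angle (f n) (opp s)) / 2 else slot_angle (f n) s)
      \<longlonglongrightarrow> (if fst (opp s) \<in> S then \<theta> s / 2 else \<theta> s)" if s: "s \<in> S \<times> UNIV" for s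
  proof (cases "fst (opp s) \<in> S")
    case True
    \<comment> \<open>Both radii vanish here, but the sum of the two centre angles depends only on
      their product, so it still converges.\<close>
    have "(\<lambda>n. arctan (tan (\<theta> s / 2) * ((1 - f n (fst s) * f n (fst (opp s))) / (1 + f n (fst s) * f n (fst (opp s))))))
        \<longlonglongrightarrow> arctan (tan (\<theta> s / 2) * ((1 - T (fst s) * T (fst (opp s))) / (1 + T (fst s) * T (fst (opp s)))))"
      using True T by (intro tendsto_intros lim) auto
    moreover have "arctan (tan (\<theta> s / 2)) = \<theta> s / 2"
      using theta_pos[of s] theta_less_pi[of s] by (intro arctan_tan) auto
    ultimately show ?thesis
      using True T by (simp add: slot_angle_add f)
  next
    case False
    have "(\<lambda>n. slot_angle (f n) s) \<longlonglongrightarrow> centre_angle (\<theta> s) (T (fst s)) (T (fst (opp s)))"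
      unfolding slot_angle_def using s False T sin_theta_pos
      by (intro tendsto_centre_angle lim) (auto simp: mem_Times_iff)
    then show ?thesis
      using s False T centre_angle_zero theta_pos theta_less_pi by (simp add: mem_Times_iff)
  qed
  then show ?thesis
    by (subst sum_symmetrize) (intro tendsto_sum)
qed

text \<open>A supersolution that minimises the sum of all \<open>T t\<close> is a solution, since a triangle with
  too small a cone angle could be shrunk further.\<close>

lemma half_cone_solution_exists:
  assumes star: "\<And>S. S \<noteq> {} \<Longrightarrow>
      pi * real (card S) < (\<Sum>s\<in>S \<times> UNIV. if fst (opp s) \<in> S then \<theta> s / 2 else \<theta> s)"
  obtains T where "\<And>t. 0 < T t" "\<And>t. T t < 1" "\<And>t. half_cone T t = pi"
proof -
  obtain c where c: "0 < c" "c < 1" "\<And>t. half_cone (\<lambda>_. c) t \<le> pi"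
    by (rule exists_equal_supersolution) blast
  \<comment> \<open>The bound \<open>c\<close> keeps limits away from 1. Since positivity is not a
    closed condition, the minimum is taken over the closure, and positivity of the minimiser is
    shown afterwards.\<close>
  define A where "A = {v :: real ^ 't. (\<forall>t. 0 < v $ t \<and> v $ t \<le> c) \<and> (\<forall>t. half_cone (($) v) t \<le> pi)}"
  define B where "B = cbox 0 (\<chi> t::'t. c)"
  have AB: "closure A \<subseteq> B"
    unfolding B_def by (intro closure_minimal closed_cbox) (auto simp: A_def mem_box_cart less_imp_le)
  have "compact (closure A)"
    using AB bounded_cbox bounded_subset unfolding B_def compact_eq_bounded_closed by blast
  moreover have "(\<chi> t. c) \<in> A"
    using c by (simp add: A_def vec_lambda_inverse)
  then have "closure A \<noteq> {}" using closure_subset by blast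
  moreover have "continuous_on (closure A) (\<lambda>v. \<Sum>t\<in>UNIV. v $ t)"
    by (intro continuous_intros)
  ultimately obtain v where v: "v \<in> closure A" and v_min: "\<And>w. w \<in> closure A \<Longrightarrow> (\<Sum>t\<in>UNIV. v $ t) \<le> (\<Sum>t\<in>UNIV. w $ t)"
    using continuous_attains_inf[of "closure A" "\<lambda>v. \<Sum>t\<in>UNIV. v $ t"] by blast
  obtain f where f: "\<And>n. f n \<in> A" "f \<longlonglongrightarrow> v"
    using v by (auto simp: closure_sequential)
  have lim: "(\<lambda>n. f n $ t) \<longlonglongrightarrow> v $ t" for t
    by (intro tendsto_vec_nth f)
  have f01: "0 < f n $ t" "f n $ t < 1" for n t
    using f(1)[of n] c by (auto simp: A_def intro: le_less_trans)
  have v_le: "0 \<le> v $ t" "v $ t \<le> c" for t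
    using AB v by (auto simp: B_def mem_box_cart)
  have v_pos: "0 < v $ t" for t
  proof (rule ccontr)
    assume "\<not> 0 < v $ t"
    \<comment> \<open>These triangles collapse along \<open>f\<close>. The cone angles of every
      \<open>f n\<close> over \<open>S\<close> add up to at most \<open>pi * card S\<close>, and the
      limit of this bound contradicts \<open>star\<close>.\<close>
    define S where "S = {t. v $ t = 0}"
    have "S \<noteq> {}" using v_le[of t] \<open>\<not> 0 < v $ t\<close> by (auto simp: S_def)
    have "(\<lambda>n. \<Sum>s\<in>S \<times> UNIV. slot_angle (($) (f n)) s) \<longlonglongrightarrow>
        (\<Sum>s\<in>S \<times> UNIV. if fst (opp s) \<in> S then \<theta> s / 2 else \<theta> s)"
      using v_le less_eq_real_def by (intro tendsto_slot_angle_degenerate[where T = "($) v"] lim f01) (auto simp: S_def)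
    moreover have "(\<Sum>s\<in>S \<times> UNIV. slot_angle (($) (f n)) s) \<le> pi * real (card S)" for n
      using f(1)[of n] sum_bounded_above[of S "half_cone (($) (f n))" pi]
      by (simp add: A_def mult.commute flip: sum_half_cone)
    ultimately have "(\<Sum>s\<in>S \<times> UNIV. if fst (opp s) \<in> S then \<theta> s / 2 else \<theta> s) \<le> pi * real (card S)"
      by (intro LIMSEQ_le_const2) auto
    then show False using star[OF \<open>S \<noteq> {}\<close>] by simp
  qed
  have v_less: "v $ t < 1" for t using v_le[of t] c by simp
  have v_cone: "half_cone (($) v) t \<le> pi" for t
  proof -
    have "(\<lambda>n. half_cone (($) (f n)) t) \<longlonglongrightarrow> half_cone (($) v) t"
      by (intro tendsto_half_cone lim v_pos v_less)
    then show ?thesis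
      using f(1) by (intro LIMSEQ_le_const2) (auto simp: A_def)
  qed
  have "half_cone (($) v) t = pi" for t
  proof (rule ccontr)
    assume "half_cone (($) v) t \<noteq> pi"
    then have less: "half_cone (($) v) t < pi" using v_cone[of t] by simp
    \<comment> \<open>Shrinking \<open>t\<close> alone keeps the strict inequality at
      \<open>t\<close> for small \<open>e\<close> by continuity, and elsewhere the cone angles do
      not grow, by \<open>half_cone_mono\<close>.\<close>
    define w where "w e = (($) v)(t := v $ t - e)" for e :: real
    have "((\<lambda>e. w e u) \<longlongrightarrow> v $ u) (at_right 0)" for u
    proof (cases "u = t")
      case True
      have "((\<lambda>e. v $ t - e) \<longlongrightarrow> v $ t - 0) (at_right 0)" by (intro tendsto_intros)
      then show ?thesis using True by (simp add: w_def)
    qed (simp add: w_def)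
    then have "((\<lambda>e. half_cone (w e) t) \<longlongrightarrow> half_cone (($) v) t) (at_right 0)"
      by (intro tendsto_half_cone v_pos v_less)
    then have "\<forall>\<^sub>F e in at_right 0. half_cone (w e) t < pi"
      using less by (rule order_tendstoD)
    moreover have "\<forall>\<^sub>F e in at_right 0. e \<in> {0<..<v $ t}"
      using v_pos[of t] by (intro eventually_at_right_real)
    ultimately have "\<forall>\<^sub>F e in at_right 0. half_cone (w e) t < pi \<and> e \<in> {0<..<v $ t}"
      by eventually_elim auto
    then obtain e where e: "half_cone (w e) t < pi" "0 < e" "e < v $ t"
      using eventually_happens'[OF trivial_limit_at_right_real] by (metis (no_types, lifting) greaterThanLessThan_iff)
    have w_le: "w e u \<le> v $ u" and w_pos: "0 < w e u" for u
      using e v_pos by (auto simp: w_def)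
    have "half_cone (w e) u \<le> pi" for u
    proof (cases "u = t")
      case False
      then have "half_cone (w e) u \<le> half_cone (($) v) u"
        using w_le w_pos v_less by (intro half_cone_mono) (auto simp: w_def)
      then show ?thesis using v_cone[of u] by simp
    qed (use e in auto)
    then have "(\<chi> u. w e u) \<in> A"
      using w_pos order_trans[OF w_le v_le(2)] by (auto simp: A_def vec_lambda_inverse)
    then have "(\<Sum>u\<in>UNIV. v $ u) \<le> (\<Sum>u\<in>UNIV. w e u)"
      using v_min[of "\<chi> u. w e u"] closure_subset by auto
    moreover have "(\<Sum>u\<in>UNIV. w e u) < (\<Sum>u\<in>UNIV. v $ u)"
      using w_le e by (intro sum_strict_mono_ex1) (auto simp: w_def)
    ultimately show False by simp
  qed
  then show ?thesis using that v_pos v_less by blast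
qed

end

section \<open>Hyperbolic trigonometry\<close>

lemma index3_add [simp]:
  fixes i :: 3
  shows "i + 1 + 1 = i + 2" "i + 1 + 2 = i" "i + 2 + 1 = i" "i + 2 + 2 = i + 1" "i + 3 = i"
proof -
  have "(3 :: 3) = 0" "(4 :: 3) = 1" by simp_all
  then show "i + 1 + 1 = i + 2" "i + 1 + 2 = i" "i + 2 + 1 = i" "i + 2 + 2 = i + 1" "i + 3 = i"
    by (simp_all add: add.assoc)
qed
lemma numeral_index3 [simp]: "(4 :: 3) = 1" "(5 :: 3) = 2"
  by simp_all

lemma index3_neq [simp]:
  fixes i :: 3
  shows "i + 1 \<noteq> i" "i + 2 \<noteq> i" "i + 1 \<noteq> i + 2" "i \<noteq> i + 1" "i \<noteq> i + 2" "i + 2 \<noteq> i + 1"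
  by simp_all

lemma UNIV_index3: "(UNIV :: 3 set) = {i, i + 1, i + 2}"
proof -
  have "j = i \<or> j = i + 1 \<or> j = i + 2" for j
    using exhaust_3[of i] exhaust_3[of j] by (elim disjE) simp_all
  then show ?thesis by blast
qed

lemma sum_index3: "(\<Sum>j\<in>UNIV. f j) = f i + f (i + 1) + f (i + 2 :: 3)"
  for f :: "3 \<Rightarrow> 'b::comm_monoid_add"
  unfolding UNIV_index3[of i] by (simp add: add.assoc)
lemma Compl_index3: "- {i} = {i + 1, i + 2 :: 3}"
  using UNIV_index3[of i] index3_neq[of i] by blast

section \<open>The hyperboloid model and the laws of cosines\<close>

lemma mink_commute: "mink p q = mink q p"
  by (simp add: mink_def)

text \<open>Reverse Cauchy-Schwarz: the squared product of the heights exceeds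
  \<open>(1 + d)\<^sup>2\<close> by a sum of three squares, which also settles the case of
  equality.\<close>

lemma mink_hyp_plane_le:
  assumes "p \<in> hyp_plane" "q \<in> hyp_plane"
  shows "mink p q \<le> -1"
    and "mink p q = -1 \<longleftrightarrow> p = q"
proof -
  define d where "d = p $ 1 * q $ 1 + p $ 2 * q $ 2"
  have p: "(p $ 3)\<^sup>2 = 1 + (p $ 1)\<^sup>2 + (p $ 2)\<^sup>2" "0 < p $ 3"
    and q: "(q $ 3)\<^sup>2 = 1 + (q $ 1)\<^sup>2 + (q $ 2)\<^sup>2" "0 < q $ 3"
    using assms by (auto simp: hyp_plane_def mink_def power2_eq_square)
  have key: "(p $ 3 * q $ 3)\<^sup>2 = (1 + d)\<^sup>2 + (p $ 1 - q $ 1)\<^sup>2 + (p $ 2 - q $ 2)\<^sup>2 + (p $ 1 * q $ 2 - p $ 2 * q $ 1)\<^sup>2"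
    unfolding power_mult_distrib p q d_def by (simp add: power2_eq_square algebra_simps)
  have "(1 + d)\<^sup>2 \<le> (p $ 3 * q $ 3)\<^sup>2" unfolding key by simp
  then have "1 + d \<le> p $ 3 * q $ 3"
    by (rule power2_le_imp_le) (simp add: p(2) q(2) less_imp_le)
  then show "mink p q \<le> -1" by (simp add: mink_def d_def)
  show "mink p q = -1 \<longleftrightarrow> p = q"
  proof
    assume "mink p q = -1"
    then have "p $ 3 * q $ 3 = 1 + d" by (simp add: mink_def d_def)
    then have "(p $ 1 - q $ 1)\<^sup>2 + (p $ 2 - q $ 2)\<^sup>2 + (p $ 1 * q $ 2 - p $ 2 * q $ 1)\<^sup>2 = 0"
      using key by simp
    then have "p $ 1 = q $ 1 \<and> p $ 2 = q $ 2"
      by (simp add: add_nonneg_eq_0_iff)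
    moreover from this have "(p $ 3)\<^sup>2 = (q $ 3)\<^sup>2"
      unfolding p(1) q(1) by simp
    then have "p $ 3 = q $ 3"
      by (rule power2_eq_imp_eq) (simp_all add: p(2) q(2) less_imp_le)
    ultimately show "p = q" by (simp add: vec_eq_iff forall_3)
  next
    assume "p = q"
    then show "mink p q = -1" using assms by (simp add: hyp_plane_def)
  qed
qed

text \<open>The right-hand side is the Gram determinant up to sign. As the form has signature (2,
  1), it equals the square of the determinant \<open>d\<close> of the three vectors.\<close>

lemma mink_gram_nonneg:
  assumes "p \<in> hyp_plane" "q \<in> hyp_plane" "r \<in> hyp_plane"
  shows "0 \<le> 1 - 2 * mink p q * mink q r * mink r p - (mink p q)\<^sup>2 - (mink q r)\<^sup>2 - (mink r p)\<^sup>2"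
proof -
  define d where "d = p $ 1 * (q $ 2 * r $ 3 - q $ 3 * r $ 2) - p $ 2 * (q $ 1 * r $ 3 - q $ 3 * r $ 1)
    + p $ 3 * (q $ 1 * r $ 2 - q $ 2 * r $ 1)"
  have "- d\<^sup>2 = mink p p * mink q q * mink r r + 2 * mink p q * mink q r * mink r p
      - mink p p * (mink q r)\<^sup>2 - mink q q * (mink r p)\<^sup>2 - mink r r * (mink p q)\<^sup>2"
    by (simp add: d_def mink_def power2_eq_square algebra_simps)
  moreover have "mink p p = -1" "mink q q = -1" "mink r r = -1"
    using assms by (auto simp: hyp_plane_def)
  ultimately have "- d\<^sup>2 = -1 + 2 * mink p q * mink q r * mink r p
      + (mink q r)\<^sup>2 + (mink r p)\<^sup>2 + (mink p q)\<^sup>2"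
    by simp
  then show ?thesis
    using zero_le_power2[of d] by linarith
qed

definition cosh_side :: "(3 \<Rightarrow> real ^ 3) \<Rightarrow> 3 \<Rightarrow> real" where
  "cosh_side P i = - mink (P (i + 1)) (P (i + 2))"

lemma cosh_side_gt_1: "hyp_triangle P \<Longrightarrow> 1 < cosh_side P i"
  using mink_hyp_plane_le[of "P (i + 1)" "P (i + 2)"]
  by (auto simp: hyp_triangle_def cosh_side_def inj_eq less_le)

lemma side_length_eq_iff:
  assumes "hyp_triangle P" "hyp_triangle Q"
  shows "side_length P i = side_length Q j \<longleftrightarrow> cosh_side P i = cosh_side Q j"
  using cosh_side_gt_1[OF assms(1), of i] cosh_side_gt_1[OF assms(2), of j]
  unfolding side_length_def hyp_dist_def
  by (metis cosh_arcosh_real cosh_side_def less_imp_le)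

text \<open>The hyperbolic law of cosines; the square roots are the hyperbolic sines of the sides
  adjacent to the corner.\<close>

lemma corner_angle_eq:
  assumes "range P \<subseteq> hyp_plane"
  shows "corner_angle P i = arccos ((cosh_side P (i + 1) * cosh_side P (i + 2) - cosh_side P i) /
    (sqrt ((cosh_side P (i + 1))\<^sup>2 - 1) * sqrt ((cosh_side P (i + 2))\<^sup>2 - 1)))"
proof -
  have dir: "mink (hyp_direction p q) (hyp_direction p r) = mink p q * mink p r + mink q r"
    if "mink p p = -1" for p q r
  proof -
    have "mink (hyp_direction p q) (hyp_direction p r) = mink q r + mink p q * mink p r * (2 + mink p p)"
      unfolding hyp_direction_def by (simp add: mink_def algebra_simps)
    then show ?thesis using that by simp
  qed
  have "mink (P j) (P j) = -1" for j
    using assms by (auto simp: hyp_plane_def)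
  then show ?thesis
    unfolding corner_angle_def hyp_angle_def Let_def
    by (simp add: dir cosh_side_def mink_commute[of "P (i + 2)"] power2_eq_square mult.commute mult.left_commute)
qed

text \<open>The sines of the angles given by the law of cosines share the numerator
  \<open>sqrt G\<close>, with \<open>G\<close> the Gram determinant. Substituting leaves a rational
  identity in \<open>X\<close>, \<open>Y\<close>, \<open>Z\<close>.\<close>

lemma dual_cosine_law_aux:
  fixes X Y Z :: real
  assumes gt: "1 < X" "1 < Y" "1 < Z" and G: "0 \<le> 1 + 2 * X * Y * Z - X\<^sup>2 - Y\<^sup>2 - Z\<^sup>2"
    and A: "A = arccos ((Y * Z - X) / (sqrt (Y\<^sup>2 - 1) * sqrt (Z\<^sup>2 - 1)))"
    and B: "B = arccos ((Z * X - Y) / (sqrt (Z\<^sup>2 - 1) * sqrt (X\<^sup>2 - 1)))"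
    and C: "C = arccos ((X * Y - Z) / (sqrt (X\<^sup>2 - 1) * sqrt (Y\<^sup>2 - 1)))"
  shows "X * (sin B * sin C) = cos A + cos B * cos C"
proof -
  define G where "G = 1 + 2 * X * Y * Z - X\<^sup>2 - Y\<^sup>2 - Z\<^sup>2"
  have angle: "cos a = (v * w - u) / (sqrt (v\<^sup>2 - 1) * sqrt (w\<^sup>2 - 1)) \<and>
      sin a = sqrt G / (sqrt (v\<^sup>2 - 1) * sqrt (w\<^sup>2 - 1))"
    if "1 < v" "1 < w" "G = 1 + 2 * u * v * w - u\<^sup>2 - v\<^sup>2 - w\<^sup>2"
      "a = arccos ((v * w - u) / (sqrt (v\<^sup>2 - 1) * sqrt (w\<^sup>2 - 1)))" for u v w a
  proof -
    let ?c = "(v * w - u) / (sqrt (v\<^sup>2 - 1) * sqrt (w\<^sup>2 - 1))"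
    have pos: "0 < v\<^sup>2 - 1" "0 < w\<^sup>2 - 1" using that by (auto simp: one_less_power)
    have c: "1 - ?c\<^sup>2 = G / ((v\<^sup>2 - 1) * (w\<^sup>2 - 1))"
    proof -
      have "?c\<^sup>2 = (v * w - u)\<^sup>2 / ((v\<^sup>2 - 1) * (w\<^sup>2 - 1))"
        using pos by (simp add: power_divide power_mult_distrib)
      moreover have "(v\<^sup>2 - 1) * (w\<^sup>2 - 1) - (v * w - u)\<^sup>2 = G"
        by (simp add: that(3) power2_eq_square algebra_simps)
      ultimately show ?thesis using pos by (simp add: divide_simps)
    qed
    have "0 \<le> G" using assms(4) by (simp add: G_def)
    then have "?c\<^sup>2 \<le> 1" using c pos by (metis divide_nonneg_pos le_diff_eq mult_pos_pos add_0)
    then have "\<bar>?c\<bar> \<le> 1" by (simp add: abs_square_le_1)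
    moreover from this have "sin a = sqrt (1 - ?c\<^sup>2)"
      unfolding that(4) by (intro sin_arccos_abs)
    ultimately show ?thesis
      unfolding that(4) c using pos by (simp add: real_sqrt_divide real_sqrt_mult cos_arccos_abs)
  qed
  have pos: "0 < X\<^sup>2 - 1" "0 < Y\<^sup>2 - 1" "0 < Z\<^sup>2 - 1" using gt by (auto simp: one_less_power)
  have G0: "0 \<le> G" using assms(4) by (simp add: G_def)
  note a = angle[OF gt(2,3) _ A] and b = angle[OF gt(3,1) _ B] and c = angle[OF gt(1,2) _ C]
  have GG: "G = 1 + 2 * X * Y * Z - X\<^sup>2 - Y\<^sup>2 - Z\<^sup>2" "G = 1 + 2 * Y * Z * X - Y\<^sup>2 - Z\<^sup>2 - X\<^sup>2"
    "G = 1 + 2 * Z * X * Y - Z\<^sup>2 - X\<^sup>2 - Y\<^sup>2"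
    by (simp_all add: G_def)
  define x y z where "x = sqrt (X\<^sup>2 - 1)" and "y = sqrt (Y\<^sup>2 - 1)" and "z = sqrt (Z\<^sup>2 - 1)"
  have sq: "x * x = X\<^sup>2 - 1" "0 < x" "0 < y" "0 < z" "sqrt G * sqrt G = G"
    using pos G0 by (auto simp: x_def y_def z_def)
  have ang: "cos A = (Y * Z - X) / (y * z)" "cos B = (Z * X - Y) / (z * x)" "cos C = (X * Y - Z) / (x * y)"
      "sin B = sqrt G / (z * x)" "sin C = sqrt G / (x * y)"
    using a[OF GG(1)] b[OF GG(2)] c[OF GG(3)] by (simp_all add: x_def y_def z_def)
  have "cos A + cos B * cos C = ((Y * Z - X) * (x * x) + (Z * X - Y) * (X * Y - Z)) / ((x * x) * (y * z))"
    using sq(2-4) by (simp add: ang divide_simps)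
  also have "(Y * Z - X) * (x * x) + (Z * X - Y) * (X * Y - Z) = X * G"
    unfolding sq(1) G_def by (simp add: power2_eq_square algebra_simps)
  also have "X * G / ((x * x) * (y * z)) = X * (sin B * sin C)"
    using sq(2-5) by (simp add: ang divide_simps)
  finally show ?thesis by simp
qed

lemma dual_cosine_law:
  assumes "hyp_triangle P"
  shows "cosh_side P i * (sin (corner_angle P (i + 1)) * sin (corner_angle P (i + 2))) =
    cos (corner_angle P i) + cos (corner_angle P (i + 1)) * cos (corner_angle P (i + 2))"
proof -
  have P: "P j \<in> hyp_plane" for j using assms by (auto simp: hyp_triangle_def)
  then have r: "range P \<subseteq> hyp_plane" by auto
  note gt = cosh_side_gt_1[OF assms]
  have "0 \<le> 1 + 2 * cosh_side P i * cosh_side P (i + 1) * cosh_side P (i + 2)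
      - (cosh_side P i)\<^sup>2 - (cosh_side P (i + 1))\<^sup>2 - (cosh_side P (i + 2))\<^sup>2"
    using mink_gram_nonneg[OF P[of i] P[of "i + 1"] P[of "i + 2"]]
    by (simp add: cosh_side_def mink_commute[of "P (i + 2)"] mult.commute mult.left_commute)
  then show ?thesis
    using corner_angle_eq[OF r, of i] corner_angle_eq[OF r, of "i + 1"] corner_angle_eq[OF r, of "i + 2"]
    by (intro dual_cosine_law_aux[OF gt[of i] gt[of "i + 1"] gt[of "i + 2"]]) (auto simp: mult.commute)
qed

section \<open>Hyperbolic triangles with prescribed angles\<close>

text \<open>\<open>X\<close>, \<open>Y\<close>, \<open>Z\<close> are the hyperbolic cosines of the
  sides that the dual law of cosines demands. The conclusions allow the ordinary law of cosines to
  recover the angles from them.\<close>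

lemma cosine_laws_inverse:
  fixes A B C :: real
  assumes "0 < A" "0 < B" "0 < C" "A + B + C < pi"
  defines "D \<equiv> (cos A)\<^sup>2 + (cos B)\<^sup>2 + (cos C)\<^sup>2 + 2 * cos A * cos B * cos C - 1"
  defines "X \<equiv> (cos A + cos B * cos C) / (sin B * sin C)"
    and "Y \<equiv> (cos B + cos C * cos A) / (sin C * sin A)"
    and "Z \<equiv> (cos C + cos A * cos B) / (sin A * sin B)"
  shows "1 < X" "sqrt (X\<^sup>2 - 1) = sqrt D / (sin B * sin C)" "0 < D"
    "Y * Z - X = cos A * D / ((sin C * sin A) * (sin A * sin B))"
proof -
  have s: "0 < sin A" "0 < sin B" "0 < sin C"
    using assms by (auto intro!: sin_gt_zero)
  \<comment> \<open>The angle sum below \<pi> is what makes the side length positive.\<close>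
  have "cos (pi - (B + C)) < cos A" using assms by (intro cos_monotone_0_pi) auto
  then have "sin B * sin C < cos A + cos B * cos C" by (simp add: cos_add cos_diff)
  then show X: "1 < X" using s by (simp add: X_def)
  have X2: "X\<^sup>2 - 1 = D / (sin B * sin C)\<^sup>2"
  proof -
    have "(cos A + cos B * cos C)\<^sup>2 - (sin B)\<^sup>2 * (sin C)\<^sup>2 = D"
      by (simp add: D_def sin_squared_eq) (simp add: power2_eq_square algebra_simps)
    then show ?thesis using s by (simp add: X_def power_divide power_mult_distrib divide_simps)
  qed
  then show "0 < D"
    using X s by (metis diff_gt_0_iff_gt one_less_power zero_less_divide_iff zero_less_numeral not_less_iff_gr_or_eq zero_less_power mult_pos_pos)
  show "sqrt (X\<^sup>2 - 1) = sqrt D / (sin B * sin C)"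
    unfolding X2 using s by (simp add: real_sqrt_divide)
  have "Y * Z - X = ((cos B + cos C * cos A) * (cos C + cos A * cos B) - (cos A + cos B * cos C) * (sin A)\<^sup>2)
      / ((sin C * sin A) * (sin A * sin B))"
    using s by (simp add: X_def Y_def Z_def divide_simps power2_eq_square)
  also have "(cos B + cos C * cos A) * (cos C + cos A * cos B) - (cos A + cos B * cos C) * (sin A)\<^sup>2 = cos A * D"
    by (simp add: D_def sin_squared_eq) (simp add: power2_eq_square algebra_simps)
  finally show "Y * Z - X = cos A * D / ((sin C * sin A) * (sin A * sin B))" .
qed

lemma hyp_triangle_exists:
  fixes \<alpha> :: "3 \<Rightarrow> real"
  assumes pos: "\<And>i. 0 < \<alpha> i" and sum: "(\<Sum>i\<in>UNIV. \<alpha> i) < pi"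
  obtains P where "hyp_triangle P" "\<And>i. corner_angle P i = \<alpha> i"
proof -
  define X where "X i = (cos (\<alpha> i) + cos (\<alpha> (i + 1)) * cos (\<alpha> (i + 2))) / (sin (\<alpha> (i + 1)) * sin (\<alpha> (i + 2)))" for i
  define S where "S i = sqrt ((X i)\<^sup>2 - 1)" for i
  define D where "D = (cos (\<alpha> 1))\<^sup>2 + (cos (\<alpha> 2))\<^sup>2 + (cos (\<alpha> 3))\<^sup>2 + 2 * cos (\<alpha> 1) * cos (\<alpha> 2) * cos (\<alpha> 3) - 1"
  have D: "D = (cos (\<alpha> i))\<^sup>2 + (cos (\<alpha> (i + 1)))\<^sup>2 + (cos (\<alpha> (i + 2)))\<^sup>2
      + 2 * cos (\<alpha> i) * cos (\<alpha> (i + 1)) * cos (\<alpha> (i + 2)) - 1" for i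
    using exhaust_3[of i] by (auto simp: D_def)
  have X1: "1 < X i" and S_eq: "S i = sqrt D / (sin (\<alpha> (i + 1)) * sin (\<alpha> (i + 2)))" and "0 < D"
    and XX: "X (i + 1) * X (i + 2) - X i =
      cos (\<alpha> i) * D / ((sin (\<alpha> (i + 2)) * sin (\<alpha> i)) * (sin (\<alpha> i) * sin (\<alpha> (i + 1))))" for i
    using cosine_laws_inverse[of "\<alpha> i" "\<alpha> (i + 1)" "\<alpha> (i + 2)"] pos sum
    by (simp_all add: X_def S_def sum_index3[of _ i] flip: D)
  have \<alpha>_less: "\<alpha> i < pi" for i
    using sum pos[of i] pos[of "i + 1"] pos[of "i + 2"] by (simp add: sum_index3[of _ i])
  have s: "0 < sin (\<alpha> i)" for i using pos \<alpha>_less by (intro sin_gt_zero) auto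
  have S: "0 < S i" "S i * S i = (X i)\<^sup>2 - 1" for i
    using X1[of i] by (auto simp: S_def one_less_power)
  have cos_eq: "(X (i + 1) * X (i + 2) - X i) / (S (i + 1) * S (i + 2)) = cos (\<alpha> i)" for i
  proof -
    have "S (i + 1) * S (i + 2) = D / ((sin (\<alpha> (i + 2)) * sin (\<alpha> i)) * (sin (\<alpha> i) * sin (\<alpha> (i + 1))))"
      using \<open>0 < D\<close> by (simp add: S_eq)
    then show ?thesis
      unfolding XX using \<open>0 < D\<close> s[of i] s[of "i + 1"] s[of "i + 2"] by simp
  qed
  \<comment> \<open>\<open>P 1\<close> is the lowest point of the hyperboloid. From it,
    \<open>P 2\<close> and \<open>P 3\<close> are placed at distances with hyperbolic cosines
    \<open>X 3\<close> and \<open>X 2\<close>, in directions enclosing the angle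
    \<open>\<alpha> 1\<close>.\<close>
  define P :: "3 \<Rightarrow> real ^ 3" where "P i = (if i = 1 then vector [0, 0, 1] else
      if i = 2 then vector [S 3, 0, X 3] else vector [S 2 * cos (\<alpha> 1), S 2 * sin (\<alpha> 1), X 2])" for i
  have P: "P 1 = vector [0, 0, 1]" "P 2 = vector [S 3, 0, X 3]"
      "P 3 = vector [S 2 * cos (\<alpha> 1), S 2 * sin (\<alpha> 1), X 2]"
    by (simp_all add: P_def)
  have "cosh_side P 1 = X 2 * X 3 - S 2 * S 3 * cos (\<alpha> 1)"
    by (simp add: cosh_side_def mink_def P algebra_simps)
  also have "\<dots> = X 1"
    using cos_eq[of 1] S(1)[of 2] S(1)[of 3] by (simp add: field_simps)
  finally have "cosh_side P 1 = X 1" .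
  moreover have "cosh_side P 2 = X 2" "cosh_side P 3 = X 3"
    by (simp_all add: cosh_side_def mink_def P)
  ultimately have side: "cosh_side P i = X i" for i using exhaust_3[of i] by auto
  have "P i \<in> hyp_plane" for i
  proof -
    have "(S 2 * cos (\<alpha> 1)) * (S 2 * cos (\<alpha> 1)) + (S 2 * sin (\<alpha> 1)) * (S 2 * sin (\<alpha> 1))
        = S 2 * S 2 * ((cos (\<alpha> 1))\<^sup>2 + (sin (\<alpha> 1))\<^sup>2)"
      by (simp only: power2_eq_square distrib_left mult_ac)
    then show ?thesis
      using exhaust_3[of i] X1[of 2] X1[of 3] S(2)
      by (auto simp: P hyp_plane_def mink_def power2_eq_square)
  qed
  then have range: "range P \<subseteq> hyp_plane" by auto
  have "inj P"
  proof (rule injI)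
    fix i j assume eq: "P i = P j"
    show "i = j"
    proof (rule ccontr)
      assume "i \<noteq> j"
      then obtain k where "{i, j} = {k + 1, k + 2}"
        using UNIV_index3[of i] by (metis UNIV_I index3_add(1,2,3,4) insertE insert_commute singletonD)
      then have "P (k + 1) = P (k + 2)" using eq by (auto simp: doubleton_eq_iff)
      then have "cosh_side P k = 1" using range by (auto simp: cosh_side_def hyp_plane_def)
      then show False using X1[of k] side by simp
    qed
  qed
  moreover have "independent (range P)"
  proof -
    have "span {P 2, P 1} \<subseteq> {v. v $ 2 = 0}"
      by (rule span_minimal) (auto simp: P subspace_def)
    then have "P 3 \<notin> span {P 2, P 1}" using S(1)[of 2] s[of 1] by (auto simp: P)
    moreover have "span {P 1} \<subseteq> {v. v $ 1 = 0}"
      by (rule span_minimal) (auto simp: P subspace_def)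
    then have "P 2 \<notin> span {P 1}" using S(1)[of 3] by (auto simp: P)
    moreover have "P 1 \<noteq> 0" by (simp add: P vec_eq_iff forall_3)
    ultimately have "independent {P 3, P 2, P 1}"
      by (metis independent_empty independent_insert independent_insertI span_empty singletonD)
    moreover have "range P = {P 3, P 2, P 1}" by (auto simp: UNIV_3)
    ultimately show ?thesis by simp
  qed
  ultimately have "hyp_triangle P" using range by (simp add: hyp_triangle_def)
  moreover have "corner_angle P i = \<alpha> i" for i
    unfolding corner_angle_eq[OF range] side
    using cos_eq[of i] arccos_cos[of "\<alpha> i"] pos[of i] \<alpha>_less[of i] by (simp add: S_def)
  ultimately show ?thesis using that by blast
qed

section \<open>Side lengths in terms of the circumradius\<close>

text \<open>The hypothesis is the dual law of cosines for the angles \<pi> - (b + c), \<pi> - (c +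
  a), \<pi> - (a + b). It turns both \<open>X - 1\<close> and \<open>X + 1\<close> into products of
  sines; their quotient is the squared tanh of half the side.\<close>

lemma half_tangent_law:
  fixes X :: real
  assumes X: "X * (sin (c + a) * sin (a + b)) = cos (c + a) * cos (a + b) - cos (b + c)"
    and nz: "sin (c + a) \<noteq> 0" "sin (a + b) \<noteq> 0"
  shows "(X - 1) * (sin b * sin c) = (X + 1) * (- sin (a + b + c) * sin a)"
proof -
  define p where "p = sin (c + a) * sin (a + b)"
  define u where "u = a + b + c"
  have "cos (c + a) * cos (a + b) - p = cos (u + a)"
    using cos_add[of "c + a" "a + b"] by (simp add: p_def u_def ac_simps)
  moreover have "cos (b + c) = cos (u - a)" by (simp add: u_def)
  ultimately have "(X - 1) * p = cos (u + a) - cos (u - a)"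
    using X by (simp add: left_diff_distrib flip: p_def)
  then have minus: "(X - 1) * p = - 2 * sin (a + b + c) * sin a"
    by (simp add: cos_add cos_diff flip: u_def)
  have "cos (c + a) * cos (a + b) + p = cos (b - c)"
    using cos_diff[of "a + b" "c + a"] by (simp add: p_def)
  then have plus: "(X + 1) * p = 2 * sin b * sin c"
    using X unfolding p_def[symmetric] by (simp add: distrib_right cos_add[of b c] cos_diff[of b c])
  have "(X - 1) * (sin b * sin c) * p = ((X - 1) * p) * (sin b * sin c)" by simp
  also have "\<dots> = (- sin (a + b + c) * sin a) * (2 * sin b * sin c)" unfolding minus by simp
  also have "\<dots> = (X + 1) * (- sin (a + b + c) * sin a) * p" unfolding plus[symmetric] by simp
  finally show ?thesis
    by (rule mult_right_cancel[of p, THEN iffD1, rotated]) (simp add: p_def nz)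
qed

text \<open>If the triangle is cut at its circumcentre into isosceles triangles, the signed base angle
  over the side \<open>i\<close> is \<open>\<pi> / 2 - side_defect \<alpha> i\<close>.\<close>

definition side_defect :: "(3 \<Rightarrow> real) \<Rightarrow> 3 \<Rightarrow> real" where
  "side_defect \<alpha> i = (pi + \<alpha> i - \<alpha> (i + 1) - \<alpha> (i + 2)) / 2"

lemma angle_eq_side_defect: "\<alpha> i = pi - side_defect \<alpha> (i + 1) - side_defect \<alpha> (i + 2)"
  by (simp add: side_defect_def field_simps)

lemma side_defect_of_angles:
  assumes "\<And>i. \<alpha> i = pi - \<psi> (i + 1) - \<psi> (i + 2)"
  shows "side_defect \<alpha> i = \<psi> i"
  unfolding side_defect_def assms by (simp add: field_simps)

lemma sum_side_defect: "(\<Sum>i\<in>UNIV. side_defect \<alpha> i) = (3 * pi - (\<Sum>i\<in>UNIV. \<alpha> i)) / 2"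
  by (simp add: sum_index3[of _ 1] side_defect_def field_simps)

text \<open>This is \<open>tanh\<^sup>2\<close> of the circumradius; it is at least \<open>1\<close> if there is no circumscribed circle.\<close>

definition circum_sq :: "(3 \<Rightarrow> real) \<Rightarrow> real" where
  "circum_sq \<psi> = - sin (\<Sum>i\<in>UNIV. \<psi> i) / (\<Prod>i\<in>UNIV. sin (\<psi> i))"

lemma prod_index3: "(\<Prod>j\<in>UNIV. f j) = f i * f (i + 1) * f (i + 2 :: 3)"
  for f :: "3 \<Rightarrow> 'b::comm_monoid_mult"
  unfolding UNIV_index3[of i] by (simp add: mult.assoc)

text \<open>In this form, acute defects visibly give a value below 1, and scaling all cotangents
  scales \<open>1 - circum_sq \<psi>\<close> quadratically.\<close>

lemma circum_sq_cot:
  assumes "\<And>i. sin (\<psi> i) \<noteq> 0"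
  shows "circum_sq \<psi> = 1 - (cot (\<psi> i) * cot (\<psi> (i + 1)) + cot (\<psi> (i + 1)) * cot (\<psi> (i + 2)) + cot (\<psi> (i + 2)) * cot (\<psi> i))"
  using sin_add3_cot[of "\<psi> i" "\<psi> (i + 1)" "\<psi> (i + 2)"] assms
  by (simp add: circum_sq_def sum_index3[of _ i] prod_index3[of _ i])

lemma side_defect_bounds:
  assumes "\<And>i. 0 < \<alpha> i" "(\<Sum>i\<in>UNIV. \<alpha> i) < pi"
  shows "0 < side_defect \<alpha> i" "side_defect \<alpha> i < pi"
  using assms(1)[of i] assms(1)[of "i + 1"] assms(1)[of "i + 2"] assms(2)
  by (auto simp: side_defect_def sum_index3[of _ i])

text \<open>The defects add up to more than \<pi> and less than 3 \<pi> / 2, where the sine is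
  negative.\<close>

lemma circum_sq_pos:
  assumes "\<And>i. 0 < \<alpha> i" "(\<Sum>i\<in>UNIV. \<alpha> i) < pi"
  shows "0 < circum_sq (side_defect \<alpha>)"
proof -
  have "0 < (\<Sum>i\<in>UNIV. \<alpha> i)" using assms by (simp add: sum_pos)
  then have "sin (\<Sum>i\<in>UNIV. side_defect \<alpha> i) < 0"
    unfolding sum_side_defect using assms by (intro sin_lt_zero) auto
  moreover have "0 < (\<Prod>i\<in>UNIV. sin (side_defect \<alpha> i))"
    using side_defect_bounds[OF assms] by (intro prod_pos ballI sin_gt_zero) auto
  ultimately show ?thesis by (simp add: circum_sq_def divide_neg_pos)
qed

text \<open>The square of tanh (l / 2) = K sin \<psi>. It holds whether or not a circumscribed
  circle exists.\<close>

lemma cosh_side_circum: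
  assumes P: "hyp_triangle P" "\<And>i. corner_angle P i = \<alpha> i"
    and \<alpha>: "\<And>i. 0 < \<alpha> i" "(\<Sum>i\<in>UNIV. \<alpha> i) < pi"
  shows "(cosh_side P i - 1) / (cosh_side P i + 1) = circum_sq (side_defect \<alpha>) * (sin (side_defect \<alpha> i))\<^sup>2"
proof -
  define X where "X = cosh_side P i"
  define a b c where "a = side_defect \<alpha> i" and "b = side_defect \<alpha> (i + 1)" and "c = side_defect \<alpha> (i + 2)"
  have X: "1 < X" using cosh_side_gt_1[OF P(1)] by (simp add: X_def)
  have sin_pos: "0 < sin (side_defect \<alpha> j)" for j
    using side_defect_bounds[OF \<alpha>] by (intro sin_gt_zero) auto
  have s: "0 < sin a" "0 < sin b" "0 < sin c" by (simp_all add: a_def b_def c_def sin_pos)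
  have al: "\<alpha> i = pi - (b + c)" "\<alpha> (i + 1) = pi - (c + a)" "\<alpha> (i + 2) = pi - (a + b)"
    using angle_eq_side_defect[of \<alpha> i] angle_eq_side_defect[of \<alpha> "i + 1"] angle_eq_side_defect[of \<alpha> "i + 2"]
    by (simp_all add: a_def b_def c_def)
  have "\<alpha> j < pi" for j
    using \<alpha>(1)[of j] \<alpha>(1)[of "j + 1"] \<alpha>(1)[of "j + 2"] \<alpha>(2) by (simp add: sum_index3[of _ j])
  then have "0 < sin (\<alpha> (i + 1))" "0 < sin (\<alpha> (i + 2))"
    using \<alpha>(1) by (auto intro: sin_gt_zero)
  then have "sin (c + a) \<noteq> 0" "sin (a + b) \<noteq> 0"
    unfolding al by simp_all
  moreover have "X * (sin (c + a) * sin (a + b)) = cos (c + a) * cos (a + b) - cos (b + c)"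
    using dual_cosine_law[OF P(1), of i] unfolding P(2) al X_def by simp
  ultimately have "(X - 1) * (sin b * sin c) = (X + 1) * (- sin (a + b + c) * sin a)"
    by (intro half_tangent_law)
  then have "(X - 1) / (X + 1) = - sin (a + b + c) * sin a / (sin b * sin c)"
    using X s by (simp add: divide_simps mult.commute)
  also have "\<dots> = circum_sq (side_defect \<alpha>) * (sin a)\<^sup>2"
    using s by (simp add: circum_sq_def sum_index3[of _ i] prod_index3[of _ i] divide_simps power2_eq_square flip: a_def b_def c_def)
  finally show ?thesis by (simp add: X_def a_def)
qed

section \<open>From defects to centre angles and back\<close>

lemma acot_scaled_le:
  assumes "0 < x" "x \<le> pi / 2" "0 < w" "w \<le> 1"
  shows "acot (cot x / w) \<le> x"
proof -
  have "0 \<le> cot x"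
    using assms by (auto simp: cot_def intro!: divide_nonneg_nonneg cos_ge_zero sin_ge_zero)
  then have "cot x \<le> cot x / w" using assms mult_right_mono[of w 1 "cot x"] by (simp add: field_simps)
  then have "acot (cot x / w) \<le> acot (cot x)" by simp
  then show ?thesis using assms acot_cot[of x] by simp
qed

text \<open>Here \<open>w\<close> is 1 / cosh of the circumradius and the summands are half the
  angles that the sides subtend at the centre. The pairwise products of the scaled cotangents add up
  to 1, so the sine of the sum vanishes; the sum lies strictly between 0 and 2 \<pi>.\<close>

lemma sum_acot_eq_pi:
  assumes \<psi>: "\<And>i. 0 < \<psi> i" "\<And>i. \<psi> (i + 1) + \<psi> (i + 2) < pi"
    and w: "0 < w" "w \<le> 1" "w\<^sup>2 = 1 - circum_sq \<psi>"
  shows "(\<Sum>i\<in>UNIV. acot (cot (\<psi> i) / w)) = pi"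
proof -
  define \<phi> where "\<phi> i = acot (cot (\<psi> i) / w)" for i
  have pi: "\<psi> i < pi" for i using \<psi>(1)[of "i + 1"] \<psi>(2)[of "i + 2"] by simp
  have sum: "(\<Sum>i\<in>UNIV. \<phi> i) = \<phi> 1 + \<phi> 2 + \<phi> 3" by (simp add: sum_index3[of _ 1])
  have \<phi>: "0 < \<phi> i" "\<phi> i < pi" for i by (simp_all add: \<phi>_def acot_bounds)
  have le: "\<phi> i \<le> \<psi> i" if "\<psi> i \<le> pi / 2" for i
    unfolding \<phi>_def using that \<psi>(1) w by (intro acot_scaled_le)
  have \<psi>_pairs: "\<psi> 1 + \<psi> 2 < pi" "\<psi> 2 + \<psi> 3 < pi" "\<psi> 3 + \<psi> 1 < pi"
    using \<psi>(2)[of 3] \<psi>(2)[of 1] \<psi>(2)[of 2] by simp_all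
  \<comment> \<open>At most one defect exceeds \<pi> / 2, so at least two of the
    \<open>\<phi> i\<close> are at most \<pi> / 2.\<close>
  have "\<phi> 1 + \<phi> 2 + \<phi> 3 < 2 * pi"
    using le[of 1] le[of 2] le[of 3] \<phi>(2)[of 1] \<phi>(2)[of 2] \<phi>(2)[of 3] \<psi>_pairs pi_gt_zero by linarith
  moreover have "sin (\<phi> 1 + \<phi> 2 + \<phi> 3) = 0"
  proof -
    have "sin (\<psi> i) \<noteq> 0" for i using sin_gt_zero[OF \<psi>(1) pi, of i] by simp
    then have "circum_sq \<psi> = 1 - (cot (\<psi> 1) * cot (\<psi> 2) + cot (\<psi> 2) * cot (\<psi> 3) + cot (\<psi> 3) * cot (\<psi> 1))"
      using circum_sq_cot[of \<psi> 1] by simp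
    then have "cot (\<psi> 1) * cot (\<psi> 2) + cot (\<psi> 2) * cot (\<psi> 3) + cot (\<psi> 3) * cot (\<psi> 1) = w\<^sup>2"
      using w by simp
    then have "cot (\<phi> 1) * cot (\<phi> 2) + cot (\<phi> 2) * cot (\<phi> 3) + cot (\<phi> 3) * cot (\<phi> 1) = 1"
      using w(1) by (simp add: \<phi>_def power2_eq_square flip: add_divide_distrib)
    moreover have "sin (\<phi> i) \<noteq> 0" for i using sin_gt_zero[OF \<phi>, of i] by simp
    ultimately show ?thesis by (simp add: sin_add3_cot)
  qed
  moreover have "0 < \<phi> 1 + \<phi> 2 + \<phi> 3" using \<phi> by (simp add: add_pos_pos)
  ultimately have "\<phi> 1 + \<phi> 2 + \<phi> 3 = pi"
    using sin_gt_zero[of "\<phi> 1 + \<phi> 2 + \<phi> 3"] sin_lt_zero[of "\<phi> 1 + \<phi> 2 + \<phi> 3"]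
    by (metis less_irrefl linorder_neqE_linordered_idom)
  then show ?thesis using sum by (simp add: \<phi>_def)
qed

lemma add_less_pi_iff_cot:
  fixes x y :: real
  assumes "0 < x" "x < pi" "0 < y" "y < pi"
  shows "x + y < pi \<longleftrightarrow> 0 < cot x + cot y"
proof -
  have s: "0 < sin x" "0 < sin y" using assms by (auto intro: sin_gt_zero)
  have "sin (x + y) = sin x * sin y * (cot x + cot y)"
    using s by (intro cot_add_eq) auto
  then have "0 < cot x + cot y \<longleftrightarrow> 0 < sin (x + y)"
    using mult_less_cancel_left_pos[OF mult_pos_pos[OF s], of 0 "cot x + cot y"] by simp
  also have "\<dots> \<longleftrightarrow> x + y < pi"
    using assms sin_gt_zero[of "x + y"] sin_le_zero[of "x + y"] by fastforce
  finally show ?thesis by simp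
qed

text \<open>Converse of \<open>sum_acot_eq_pi\<close>. A positive factor keeps the signs of sums of
  two cotangents, which gives the pair bounds. Positivity of \<open>1 - w\<^sup>2\<close> makes the
  sine of the sum negative, so the sum exceeds \<pi> and the resulting angles are
  hyperbolic.\<close>

lemma scaled_cot_triangle:
  assumes \<phi>: "\<And>i. 0 < \<phi> i" "(\<Sum>i\<in>UNIV. \<phi> i) = pi"
    and w: "0 < w" "w < 1"
    and \<psi>: "\<And>i. \<psi> i = acot (w * cot (\<phi> i))"
  shows "\<psi> (i + 1) + \<psi> (i + 2) < pi" "pi < (\<Sum>i\<in>UNIV. \<psi> i)" "circum_sq \<psi> = 1 - w\<^sup>2"
proof -
  have \<phi>_pair: "\<phi> (i + 1) + \<phi> (i + 2) < pi" for i
    using \<phi>(1)[of i] \<phi>(2) by (simp add: sum_index3[of _ i])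
  have \<phi>_pi: "\<phi> i < pi" for i using \<phi>_pair[of "i + 1"] \<phi>(1)[of "i + 2"] \<phi>(1)[of i] by simp
  have \<psi>_b: "0 < \<psi> i" "\<psi> i < pi" for i by (simp_all add: \<psi> acot_bounds)
  have cot: "cot (\<psi> i) = w * cot (\<phi> i)" for i by (simp add: \<psi>)
  show pair: "\<psi> (i + 1) + \<psi> (i + 2) < pi" for i
  proof -
    have "0 < cot (\<phi> (i + 1)) + cot (\<phi> (i + 2))"
      using \<phi>_pair add_less_pi_iff_cot \<phi> \<phi>_pi by blast
    then have "0 < cot (\<psi> (i + 1)) + cot (\<psi> (i + 2))"
      unfolding cot using w by (simp flip: distrib_left)
    then show ?thesis using add_less_pi_iff_cot \<psi>_b by blast
  qed
  have s\<phi>: "0 < sin (\<phi> i)" for i by (intro sin_gt_zero \<phi> \<phi>_pi)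
  have s\<psi>: "0 < sin (\<psi> i)" for i by (intro sin_gt_zero \<psi>_b)
  have "sin (\<phi> 1 + \<phi> 2 + \<phi> 3) = 0"
    using \<phi>(2) by (simp add: sum_index3[of _ 1])
  then have one: "cot (\<phi> 1) * cot (\<phi> 2) + cot (\<phi> 2) * cot (\<phi> 3) + cot (\<phi> 3) * cot (\<phi> 1) = 1"
    using s\<phi>[of 1] s\<phi>[of 2] s\<phi>[of 3] by (simp add: sin_add3_cot)
  have "sin (\<psi> i) \<noteq> 0" for i using s\<psi>[of i] by simp
  then have "circum_sq \<psi> = 1 - w\<^sup>2 * (cot (\<phi> 1) * cot (\<phi> 2) + cot (\<phi> 2) * cot (\<phi> 3) + cot (\<phi> 3) * cot (\<phi> 1))"
    using circum_sq_cot[of \<psi> 1] by (simp add: cot power2_eq_square algebra_simps)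
  then show c: "circum_sq \<psi> = 1 - w\<^sup>2" by (simp add: one)
  have "w\<^sup>2 < 1" using w by (simp add: power_less_one_iff)
  moreover have "0 < (\<Prod>i\<in>UNIV. sin (\<psi> i))" by (intro prod_pos ballI s\<psi>)
  moreover from calculation have "0 < circum_sq \<psi>" by (simp add: c)
  ultimately have neg: "sin (\<Sum>i\<in>UNIV. \<psi> i) < 0"
    by (simp add: circum_sq_def divide_less_0_iff)
  show "pi < (\<Sum>i\<in>UNIV. \<psi> i)"
  proof (rule ccontr)
    assume "\<not> ?thesis"
    then have "0 \<le> sin (\<Sum>i\<in>UNIV. \<psi> i)"
      using \<psi>_b by (intro sin_ge_zero sum_nonneg) (auto intro: less_imp_le)
    then show False using neg by simp
  qed
qed

section \<open>Matching two triangles along an edge\<close>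

text \<open>\<open>tanh R\<close> as a function of \<open>tanh (R / 2)\<close>.\<close>

definition circum_of :: "real \<Rightarrow> real" where
  "circum_of T = 2 * T / (1 + T\<^sup>2)"

lemma circum_of_pos: "0 < T \<Longrightarrow> 0 < circum_of T"
  by (simp add: circum_of_def add_pos_nonneg)

lemma circum_of_ratio:
  assumes "0 < T" "0 < T'"
  shows "T * (1 + T'\<^sup>2) / (T' * (1 + T\<^sup>2)) = circum_of T / circum_of T'"
proof -
  have "0 < 1 + T\<^sup>2" "0 < 1 + T'\<^sup>2" by (auto intro: add_pos_nonneg)
  then show ?thesis using assms by (simp add: circum_of_def)
qed

lemma circum_of_sq: "(circum_of T)\<^sup>2 = 1 - ((1 - T\<^sup>2) / (1 + T\<^sup>2))\<^sup>2"
proof -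
  have "0 < 1 + T\<^sup>2" by (auto intro: add_pos_nonneg)
  then have "1 + T\<^sup>2 \<noteq> 0" by simp
  then have "1 - ((1 - T\<^sup>2) / (1 + T\<^sup>2))\<^sup>2 = ((1 + T\<^sup>2)\<^sup>2 - (1 - T\<^sup>2)\<^sup>2) / (1 + T\<^sup>2)\<^sup>2"
    by (simp add: power_divide divide_simps)
  also have "(1 + T\<^sup>2)\<^sup>2 - (1 - T\<^sup>2)\<^sup>2 = (2 * T)\<^sup>2"
    by (simp add: power2_eq_square algebra_simps)
  finally show ?thesis by (simp add: circum_of_def power_divide)
qed

lemma circum_of_surj:
  assumes "0 < K" "K < 1"
  obtains T where "0 < T" "T < 1" "circum_of T = K"
proof -
  define w where "w = sqrt (1 - K\<^sup>2)"
  have "K\<^sup>2 < 1" using assms by (simp add: power_less_one_iff)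
  then have w: "0 < w" "w * w = 1 - K\<^sup>2" by (simp_all add: w_def)
  \<comment> \<open>The half-argument formula tanh (R / 2) = tanh R / (1 + 1 / cosh R), with
    \<open>w\<close> as 1 / cosh R.\<close>
  define T where "T = K / (1 + w)"
  have "1 + T\<^sup>2 = ((1 + w) * (1 + w) + K\<^sup>2) / ((1 + w) * (1 + w))"
    using w(1) by (simp add: T_def power2_eq_square divide_simps)
  also have "(1 + w) * (1 + w) + K\<^sup>2 = 2 * (1 + w)"
    using w(2) by (simp add: algebra_simps)
  also have "2 * (1 + w) / ((1 + w) * (1 + w)) = 2 / (1 + w)"
    using w(1) by (intro nonzero_mult_divide_mult_cancel_right) simp
  finally have "circum_of T = K" using w(1) by (simp add: circum_of_def T_def)
  moreover have "0 < T" "T < 1" using assms w by (auto simp: T_def)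
  ultimately show ?thesis using that by blast
qed

text \<open>If \<open>x\<close> and \<open>\<theta> - x\<close> are the two defects at an edge, the
  right-hand equation says that both triangles give it the same length.\<close>

lemma base_cot_eq_iff:
  assumes "0 < T" "0 < T'" "0 < \<theta>" "\<theta> < pi" "0 < x" "x < pi"
  shows "cot x = base_cot \<theta> T T' \<longleftrightarrow> circum_of T * sin x = circum_of T' * sin (\<theta> - x)"
proof -
  have s: "0 < sin x" "0 < sin \<theta>" using assms by (auto intro: sin_gt_zero)
  have K: "0 < circum_of T'" using assms by (simp add: circum_of_pos)
  have sd: "sin (\<theta> - x) = sin x * (sin \<theta> * cot x - cos \<theta>)"
    using s by (simp add: sin_diff cot_def field_simps)
  then have "circum_of T * sin x = circum_of T' * sin (\<theta> - x) \<longleftrightarrow>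
      (circum_of T - circum_of T' * (sin \<theta> * cot x - cos \<theta>)) * sin x = 0"
    unfolding sd by (simp add: algebra_simps)
  also have "\<dots> \<longleftrightarrow> circum_of T / circum_of T' = sin \<theta> * cot x - cos \<theta>"
    using s K by (simp add: nonzero_divide_eq_eq mult.commute)
  also have "\<dots> \<longleftrightarrow> cot x = (circum_of T / circum_of T' + cos \<theta>) / sin \<theta>"
    using s by (auto simp: field_simps)
  finally show ?thesis
    using assms by (simp add: base_cot_def circum_of_ratio)
qed

text \<open>The sine equation of \<open>base_cot_eq_iff\<close> is symmetric under exchanging the
  circles together with \<open>x\<close> and \<open>\<theta> - x\<close>.\<close>

lemma acot_base_cot_add:
  assumes "0 < T" "0 < T'" "0 < \<theta>" "\<theta> < pi"
  shows "acot (base_cot \<theta> T T') + acot (base_cot \<theta> T' T) = \<theta>"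
proof -
  define x where "x = acot (base_cot \<theta> T T')"
  have x: "0 < x" "x < pi" "cot x = base_cot \<theta> T T'"
    by (simp_all add: x_def acot_bounds)
  then have eq: "circum_of T * sin x = circum_of T' * sin (\<theta> - x)"
    using base_cot_eq_iff assms by blast
  have "0 < sin x" using x by (intro sin_gt_zero)
  then have "0 < circum_of T' * sin (\<theta> - x)"
    unfolding eq[symmetric] using circum_of_pos assms by simp
  then have "0 < sin (\<theta> - x)"
    using circum_of_pos[of T'] assms by (simp add: zero_less_mult_iff)
  have "x < \<theta>"
  proof (rule ccontr)
    assume "\<not> x < \<theta>"
    then have "0 \<le> sin (x - \<theta>)" using x assms by (intro sin_ge_zero) auto
    then show False using \<open>0 < sin (\<theta> - x)\<close> sin_minus[of "\<theta> - x"] by simp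
  qed
  then have "cot (\<theta> - x) = base_cot \<theta> T' T"
    using x eq assms by (subst base_cot_eq_iff) auto
  then have "acot (base_cot \<theta> T' T) = \<theta> - x"
    using acot_cot[of "\<theta> - x"] \<open>x < \<theta>\<close> x assms by simp
  then show ?thesis by (simp add: x_def)
qed

section \<open>Slots of a triangulation\<close>

lemma mem_model_triangle_axis: "axis i 1 \<in> model_triangle"
  by (auto simp: model_triangle_def axis_def)

lemma open_face_singleton: "p \<in> open_face {j} \<Longrightarrow> p = axis j 1"
proof -
  assume p: "p \<in> open_face {j}"
  then have pos: "\<And>i. 0 \<le> p $ i" and sum: "(\<Sum>i\<in>UNIV. p $ i) = 1" and supp: "{i. p $ i > 0} = {j}"
    by (auto simp: open_face_def model_triangle_def)
  have zero: "p $ i = 0" if "i \<noteq> j" for i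
    using supp pos[of i] that by (auto simp: set_eq_iff less_le)
  then have "(\<Sum>i\<in>UNIV. p $ i) = p $ j"
    by (simp add: sum_index3[of _ j])
  then show ?thesis using sum zero by (auto simp: vec_eq_iff axis_def)
qed

lemma axis_mem_open_face: "axis j 1 \<in> open_face {j}"
  using mem_model_triangle_axis by (auto simp: open_face_def axis_def)

lemma vertex_mem_edge: "j \<noteq> i \<Longrightarrow> vertex \<phi> t j \<in> edge \<phi> t i"
  using mem_model_triangle_axis by (auto simp: vertex_def edge_def axis_def)

text \<open>Cells have a well-defined dimension, so a vertex lying on a side can only be the image
  of a corner of that side.\<close>

lemma vertex_mem_edgeD:
  assumes tri: "topological_triangulation M \<phi>"
    and "vertex \<phi> t j \<in> edge \<phi> t' i'"
  shows "vertex \<phi> t j \<in> {vertex \<phi> t' (i' + 1), vertex \<phi> t' (i' + 2)}"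
proof -
  obtain p where p: "p \<in> model_triangle" "p $ i' = 0" "vertex \<phi> t j = \<phi> t' p"
    using assms(2) by (auto simp: edge_def)
  define J where "J = {i. p $ i > 0}"
  have "p \<in> open_face J" using p by (simp add: open_face_def J_def)
  then have "\<phi> t ` open_face {j} \<inter> \<phi> t' ` open_face J \<noteq> {}"
    using p(3) axis_mem_open_face[of j] by (auto simp: vertex_def)
  then have "card {j} = card J"
    using tri unfolding topological_triangulation_def by metis
  then obtain k where k: "J = {k}" by (metis card_1_singletonE is_singletonI is_singleton_altdef)
  then have "p = axis k 1" using open_face_singleton \<open>p \<in> open_face J\<close> by blast
  moreover have "k \<noteq> i'" using k p(2) by (auto simp: J_def)
  then have "k = i' + 1 \<or> k = i' + 2" using UNIV_index3[of i'] by blast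
  ultimately show ?thesis using p(3) by (auto simp: vertex_def)
qed

text \<open>Only unordered pairs can be compared, since two sides may be glued in either
  direction.\<close>

lemma edge_vertices_cong:
  assumes "topological_triangulation M \<phi>" "edge \<phi> t i = edge \<phi> t' i'"
  shows "{vertex \<phi> t (i + 1), vertex \<phi> t (i + 2)} = {vertex \<phi> t' (i' + 1), vertex \<phi> t' (i' + 2)}"
proof -
  have sub: "{vertex \<phi> t (i + 1), vertex \<phi> t (i + 2)} \<subseteq> {vertex \<phi> t' (i' + 1), vertex \<phi> t' (i' + 2)}"
    if "edge \<phi> t i = edge \<phi> t' i'" for t i t' i'
    using vertex_mem_edgeD[OF assms(1), of t "i + 1" t' i'] vertex_mem_edgeD[OF assms(1), of t "i + 2" t' i']
      vertex_mem_edge[of "i + 1" i \<phi> t] vertex_mem_edge[of "i + 2" i \<phi> t] that by auto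
  show ?thesis
    by (intro equalityI sub) (simp_all add: assms(2))
qed

definition slot_edge :: "('t \<Rightarrow> real ^ 3 \<Rightarrow> 'a) \<Rightarrow> 't \<times> 3 \<Rightarrow> 'a set" where
  "slot_edge \<phi> s = edge \<phi> (fst s) (snd s)"

text \<open>Well defined because an edge has exactly two slots, possibly in the same
  triangle.\<close>

definition other_slot :: "('t \<Rightarrow> real ^ 3 \<Rightarrow> 'a) \<Rightarrow> 't \<times> 3 \<Rightarrow> 't \<times> 3" where
  "other_slot \<phi> s = (THE s'. s' \<noteq> s \<and> slot_edge \<phi> s' = slot_edge \<phi> s)"

lemma edge_slots_iff: "s \<in> edge_slots \<phi> e \<longleftrightarrow> slot_edge \<phi> s = e"
  by (auto simp: edge_slots_def slot_edge_def)

lemma edges_of_eq: "edges_of \<phi> S = slot_edge \<phi> ` (S \<times> UNIV)"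
proof
  show "edges_of \<phi> S \<subseteq> slot_edge \<phi> ` (S \<times> UNIV)"
    unfolding edges_of_def slot_edge_def by force
qed (auto simp: edges_of_def slot_edge_def)

lemma other_slot_props:
  assumes "topological_triangulation M \<phi>"
  shows "other_slot \<phi> s \<noteq> s" "edge_slots \<phi> (slot_edge \<phi> s) = {s, other_slot \<phi> s}"
proof -
  have "slot_edge \<phi> s \<in> edges \<phi>" by (auto simp: edges_of_eq)
  then have "card (edge_slots \<phi> (slot_edge \<phi> s)) = 2"
    using assms by (auto simp: topological_triangulation_def)
  moreover have "s \<in> edge_slots \<phi> (slot_edge \<phi> s)" by (simp add: edge_slots_iff)
  ultimately obtain r where r: "r \<noteq> s" "edge_slots \<phi> (slot_edge \<phi> s) = {s, r}"
    by (metis card_2_iff doubleton_eq_iff insertE singletonD)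
  have "other_slot \<phi> s = r"
    unfolding other_slot_def
  proof (rule the_equality)
    show "r \<noteq> s \<and> slot_edge \<phi> r = slot_edge \<phi> s"
      using r edge_slots_iff[of r \<phi>] by auto
    show "q = r" if "q \<noteq> s \<and> slot_edge \<phi> q = slot_edge \<phi> s" for q
      using that r edge_slots_iff[of q \<phi>] by auto
  qed
  then show "other_slot \<phi> s \<noteq> s" "edge_slots \<phi> (slot_edge \<phi> s) = {s, other_slot \<phi> s}"
    using r by simp_all
qed

lemma slot_edge_eq_iff:
  assumes "topological_triangulation M \<phi>"
  shows "slot_edge \<phi> r = slot_edge \<phi> s \<longleftrightarrow> r = s \<or> r = other_slot \<phi> s"
  using other_slot_props(2)[OF assms, of s] edge_slots_iff[of r \<phi> "slot_edge \<phi> s"] by auto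

lemma slot_edge_other_slot:
  "topological_triangulation M \<phi> \<Longrightarrow> slot_edge \<phi> (other_slot \<phi> s) = slot_edge \<phi> s"
  by (simp add: slot_edge_eq_iff)

lemma other_slot_other_slot:
  assumes "topological_triangulation M \<phi>"
  shows "other_slot \<phi> (other_slot \<phi> s) = s"
  using slot_edge_eq_iff[OF assms, of s "other_slot \<phi> s"] slot_edge_other_slot[OF assms, of s]
    other_slot_props(1)[OF assms, of s] by auto

section \<open>Cone angles at the vertices\<close>

definition slot_defect :: "('t \<Rightarrow> 3 \<Rightarrow> real) \<Rightarrow> 't \<times> 3 \<Rightarrow> real" where
  "slot_defect x s = side_defect (x (fst s)) (snd s)"

lemma theta_slot_edge:
  assumes "topological_triangulation M \<phi>"
  shows "theta \<phi> x (slot_edge \<phi> s) = slot_defect x s + slot_defect x (other_slot \<phi> s)"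
proof -
  have "theta \<phi> x (slot_edge \<phi> s) = (\<Sum>s\<in>edge_slots \<phi> (slot_edge \<phi> s). slot_defect x s)"
    unfolding theta_def slot_defect_def side_defect_def
    by (intro sum.cong refl) (auto simp: Compl_index3 diff_diff_eq)
  then show ?thesis
    using other_slot_props[OF assms, of s] by simp
qed

text \<open>Around a vertex, every edge contributes both of its defects, so that the cone angle is a
  function of the values of \<open>theta\<close> alone.\<close>

lemma vertex_sum_cong:
  fixes \<phi> :: "'t::finite \<Rightarrow> real ^ 3 \<Rightarrow> 'a"
  assumes tri: "topological_triangulation M \<phi>"
    and th: "\<And>e. e \<in> edges \<phi> \<Longrightarrow> theta \<phi> x e = theta \<phi> y e"
  shows "(\<Sum>(t, i)\<in>vertex_slots \<phi> v. x t i) = (\<Sum>(t, i)\<in>vertex_slots \<phi> v. y t i)"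
proof -
  \<comment> \<open>\<open>m s\<close> counts the endpoints of the side that are mapped to
    \<open>v\<close>. Gluing reverses the sign of \<open>d\<close> and preserves \<open>m\<close>,
    so their pairing over all slots cancels.\<close>
  define d where "d s = slot_defect x s - slot_defect y s" for s
  define ind where "ind t i = (if vertex \<phi> t i = v then 1 else 0 :: real)" for t i
  define m where "m s = ind (fst s) (snd s + 1) + ind (fst s) (snd s + 2)" for s
  have d_other: "d (other_slot \<phi> s) = - d s" for s
  proof -
    have "slot_edge \<phi> s \<in> edges \<phi>" by (auto simp: edges_of_eq)
    from th[OF this] show ?thesis by (simp add: theta_slot_edge[OF tri] d_def)
  qed
  have m_other: "m (other_slot \<phi> s) = m s" for s
  proof -
    have "edge \<phi> (fst (other_slot \<phi> s)) (snd (other_slot \<phi> s)) = edge \<phi> (fst s) (snd s)"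
      using slot_edge_other_slot[OF tri, of s] by (simp add: slot_edge_def)
    from edge_vertices_cong[OF tri this] show ?thesis
      unfolding m_def ind_def doubleton_eq_iff by (elim disjE conjE) (simp_all only: add.commute)
  qed
  have "(\<Sum>s\<in>UNIV. d s * m s) = (\<Sum>s\<in>UNIV. d (other_slot \<phi> s) * m (other_slot \<phi> s))"
    by (rule sum.reindex_bij_witness[of _ "other_slot \<phi>" "other_slot \<phi>"])
      (auto simp: other_slot_other_slot[OF tri])
  then have zero: "(\<Sum>s\<in>UNIV. d s * m s) = 0"
    by (simp add: d_other m_other sum_negf)
  have per_triangle: "(\<Sum>i\<in>UNIV. (x t i - y t i) * ind t i) = - (\<Sum>i\<in>UNIV. d (t, i) * m (t, i))" for t
  proof -
    have diff: "x t i - y t i = - d (t, i + 1) - d (t, i + 2)" for i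
      using angle_eq_side_defect[of "x t" i] angle_eq_side_defect[of "y t" i]
      by (simp add: d_def slot_defect_def)
    show ?thesis
      unfolding diff by (simp add: sum_index3[of _ 1] m_def algebra_simps)
  qed
  have "(\<Sum>s\<in>vertex_slots \<phi> v. x (fst s) (snd s) - y (fst s) (snd s)) =
      (\<Sum>s\<in>UNIV. (x (fst s) (snd s) - y (fst s) (snd s)) * ind (fst s) (snd s))"
  proof (rule sum.mono_neutral_cong_left)
    have mem: "s \<in> vertex_slots \<phi> v \<longleftrightarrow> vertex \<phi> (fst s) (snd s) = v" for s
      by (cases s) (simp add: vertex_slots_def)
    show "\<forall>s\<in>UNIV - vertex_slots \<phi> v. (x (fst s) (snd s) - y (fst s) (snd s)) * ind (fst s) (snd s) = 0"
      by (simp add: mem ind_def)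
    show "x (fst s) (snd s) - y (fst s) (snd s) = (x (fst s) (snd s) - y (fst s) (snd s)) * ind (fst s) (snd s)"
      if "s \<in> vertex_slots \<phi> v" for s
      using that by (simp add: mem ind_def)
  qed simp_all
  also have "\<dots> = (\<Sum>t\<in>UNIV. \<Sum>i\<in>UNIV. (x t i - y t i) * ind t i)"
    by (simp add: sum.cartesian_product case_prod_unfold)
  also have "\<dots> = - (\<Sum>s\<in>UNIV. d s * m s)"
    by (simp add: per_triangle sum_negf sum.cartesian_product)
  finally show ?thesis by (simp add: zero case_prod_unfold sum_subtractf)
qed

section \<open>Uniform angle systems as circle patterns\<close>

locale delaunay_surface =
  fixes M :: "'a topology" and \<phi> :: "'t::finite \<Rightarrow> real ^ 3 \<Rightarrow> 'a" and x :: "'t \<Rightarrow> 3 \<Rightarrow> real"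
  assumes tri: "topological_triangulation M \<phi>"
    and del: "delaunay \<phi> x"
begin

abbreviation opp :: "'t \<times> 3 \<Rightarrow> 't \<times> 3" where
  "opp \<equiv> other_slot \<phi>"

abbreviation \<theta> :: "'t \<times> 3 \<Rightarrow> real" where
  "\<theta> s \<equiv> theta \<phi> x (slot_edge \<phi> s)"

sublocale edge_gluing opp \<theta>
proof
  fix s
  have "slot_edge \<phi> s \<in> edges \<phi>" by (auto simp: edges_of_eq)
  then have "\<theta> s \<in> {0<..<pi}" using del unfolding delaunay_def by blast
  then show "0 < \<theta> s" "\<theta> s < pi" by auto
qed (simp_all add: other_slot_other_slot[OF tri] slot_edge_other_slot[OF tri])

text \<open>An edge with both slots in \<open>S\<close> is met twice on the right, hence the
  halves.\<close>

lemma sum_theta_edges_of: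
  "(\<Sum>e\<in>edges_of \<phi> S. theta \<phi> x e) = (\<Sum>s\<in>S \<times> UNIV. if fst (opp s) \<in> S then \<theta> s / 2 else \<theta> s)"
proof -
  let ?g = "\<lambda>s. if fst (opp s) \<in> S then \<theta> s / 2 else \<theta> s"
  have "sum ?g (S \<times> UNIV) = (\<Sum>e\<in>slot_edge \<phi> ` (S \<times> UNIV). \<Sum>s\<in>{s \<in> S \<times> UNIV. slot_edge \<phi> s = e}. ?g s)"
    by (rule sum.image_gen) simp
  also have "\<dots> = (\<Sum>e\<in>edges_of \<phi> S. theta \<phi> x e)"
    unfolding edges_of_eq
  proof (rule sum.cong[OF refl])
    fix e assume "e \<in> slot_edge \<phi> ` (S \<times> UNIV)"
    then obtain s where s: "fst s \<in> S" "e = slot_edge \<phi> s" by auto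
    have ne: "opp s \<noteq> s" by (rule other_slot_props(1)[OF tri])
    have "{r \<in> S \<times> UNIV. slot_edge \<phi> r = e} = (if fst (opp s) \<in> S then {s, opp s} else {s})"
      using s by (auto simp: slot_edge_eq_iff[OF tri] mem_Times_iff)
    then show "(\<Sum>s\<in>{s \<in> S \<times> UNIV. slot_edge \<phi> s = e}. ?g s) = theta \<phi> x e"
      using s ne not_sym[OF ne] by (simp add: slot_edge_other_slot[OF tri] other_slot_other_slot[OF tri])
  qed
  finally show ?thesis by simp
qed

text \<open>The vertex sums are inherited from \<open>x\<close> by \<open>vertex_sum_cong\<close>,
  and so are the bounds on \<open>theta\<close>. Only the range of the angles and the edge equations
  remain.\<close>

lemma conformally_equivalent_iff:
  "conformally_equivalent \<phi> x y \<longleftrightarrow> (\<forall>t i. 0 < y t i \<and> y t i < pi) \<and>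
     (\<forall>s. slot_defect y s + slot_defect y (opp s) = \<theta> s)"
proof
  assume conf: "conformally_equivalent \<phi> x y"
  have "slot_defect y s + slot_defect y (opp s) = \<theta> s" for s
  proof -
    have "slot_edge \<phi> s \<in> edges \<phi>" by (auto simp: edges_of_eq)
    then have "theta \<phi> x (slot_edge \<phi> s) = theta \<phi> y (slot_edge \<phi> s)"
      using conf unfolding conformally_equivalent_def by blast
    then show ?thesis by (simp add: theta_slot_edge[OF tri, of y])
  qed
  moreover have "y t i \<in> {0<..<pi}" for t i
    using conf unfolding conformally_equivalent_def delaunay_def by blast
  ultimately show "(\<forall>t i. 0 < y t i \<and> y t i < pi) \<and> (\<forall>s. slot_defect y s + slot_defect y (opp s) = \<theta> s)"
    unfolding greaterThanLessThan_iff by blast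
next
  assume y: "(\<forall>t i. 0 < y t i \<and> y t i < pi) \<and> (\<forall>s. slot_defect y s + slot_defect y (opp s) = \<theta> s)"
  have th: "theta \<phi> x e = theta \<phi> y e" if e: "e \<in> edges \<phi>" for e
  proof -
    obtain s where "e = slot_edge \<phi> s" using e unfolding edges_of_eq by blast
    moreover have "slot_defect y s + slot_defect y (opp s) = \<theta> s" using y by blast
    ultimately show ?thesis by (simp add: theta_slot_edge[OF tri, of y])
  qed
  have "delaunay \<phi> y"
    unfolding delaunay_def
  proof (intro conjI ballI allI)
    show "y t i \<in> {0<..<pi}" for t i using y by simp
    show "theta \<phi> y e \<in> {0<..<pi}" if "e \<in> edges \<phi>" for e
      using that del unfolding th[OF that, symmetric] delaunay_def by blast
    show "(\<Sum>(t, i)\<in>vertex_slots \<phi> v. y t i) = 2 * pi" if "v \<in> {vertex \<phi> t i |t i. True}" for v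
    proof -
      have "(\<Sum>(t, i)\<in>vertex_slots \<phi> v. x t i) = 2 * pi"
        using that del unfolding delaunay_def by blast
      then show ?thesis using vertex_sum_cong[OF tri th, of v] by simp
    qed
  qed
  then show "conformally_equivalent \<phi> x y"
    using del th by (simp add: conformally_equivalent_def)
qed

lemma solution_of_uniform:
  assumes unif: "uniform \<phi> y" and conf: "conformally_equivalent \<phi> x y"
  obtains T where "\<And>t. 0 < T t" "\<And>t. T t < 1" "\<And>t. half_cone T t = pi"
    "\<And>s. cot (slot_defect y s) = base_cot (\<theta> s) (T (fst s)) (T (fst (opp s)))"
proof -
  have y: "0 < y t i" for t i using conf by (auto simp: conformally_equivalent_iff)
  have defect_add: "slot_defect y s + slot_defect y (opp s) = \<theta> s" for s
    using conf unfolding conformally_equivalent_iff by blast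
  have sum: "(\<Sum>i\<in>UNIV. y t i) < pi" for t
    using unif by (simp add: uniform_def curvature_def)
  obtain P where P: "\<And>t. hyp_triangle (P t)" "\<And>t i. corner_angle (P t) i = y t i"
      "\<And>t i t' i'. edge \<phi> t i = edge \<phi> t' i' \<Longrightarrow> side_length (P t) i = side_length (P t') i'"
 proof -
    have "\<exists>P. (\<forall>t. hyp_triangle (P t) \<and> (\<forall>i. corner_angle (P t) i = y t i)) \<and>
          (\<forall>t i t' i'. edge \<phi> t i = edge \<phi> t' i' \<longrightarrow> side_length (P t) i = side_length (P t') i')"
      using unif by (simp only: uniform_def)
    then show ?thesis using that by (elim exE conjE) metis
  qed
  have defect: "0 < slot_defect y s" "slot_defect y s < pi" for s
    unfolding slot_defect_def using side_defect_bounds y sum by blast+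
  have sin_pos: "0 < sin (slot_defect y s)" for s by (intro sin_gt_zero defect)
  define K where "K t = sqrt (circum_sq (side_defect (y t)))" for t
  have K_pos: "0 < K t" and K_sq: "(K t)\<^sup>2 = circum_sq (side_defect (y t))" for t
    using circum_sq_pos[of "y t"] y sum by (auto simp: K_def)
  have K_eq: "K (fst s) * sin (slot_defect y s) = K (fst (opp s)) * sin (slot_defect y (opp s))" for s
  proof -
    have side: "(cosh_side (P (fst s)) (snd s) - 1) / (cosh_side (P (fst s)) (snd s) + 1)
        = (K (fst s) * sin (slot_defect y s))\<^sup>2" for s
      unfolding power_mult_distrib K_sq slot_defect_def
      by (rule cosh_side_circum[OF P(1,2) y sum])
    have "edge \<phi> (fst s) (snd s) = edge \<phi> (fst (opp s)) (snd (opp s))"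
      using slot_edge_other_slot[OF tri, of s] by (simp add: slot_edge_def)
    from P(3)[OF this] have "cosh_side (P (fst s)) (snd s) = cosh_side (P (fst (opp s))) (snd (opp s))"
      by (simp add: side_length_eq_iff P(1))
    then have "(K (fst s) * sin (slot_defect y s))\<^sup>2 = (K (fst (opp s)) * sin (slot_defect y (opp s)))\<^sup>2"
      by (simp flip: side)
    then show ?thesis
      by (rule power2_eq_imp_eq) (simp_all add: K_pos sin_pos less_imp_le)
  qed
  \<comment> \<open>A triangle with the largest circumradius has all its defects below \<open>\<pi> / 2\<close>.\<close>
  have K_less: "K t < 1" for t
  proof -
    obtain t0 where t0: "K t0 = Max (range K)"
      using Max_in[of "range K"] by (metis finite finite_imageI empty_not_UNIV image_is_empty imageE)
    have K_max: "K t \<le> K t0" for t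
      unfolding t0 by simp
    have half: "slot_defect y (t0, i) < pi / 2" for i
    proof (rule ccontr)
      let ?s = "(t0, i)"
      assume "\<not> slot_defect y ?s < pi / 2"
      \<comment> \<open>Maximality of \<open>K t0\<close> makes the sine of the opposite defect at
        least that of this one. But the opposite defect is smaller than \<pi> minus this one, which
        is at most \<pi> / 2.\<close>
      have "K t0 * sin (slot_defect y ?s) \<le> K t0 * sin (slot_defect y (opp ?s))"
        using K_eq[of ?s] mult_right_mono[OF K_max[of "fst (opp ?s)"], of "sin (slot_defect y (opp ?s))"] sin_pos[of "opp ?s"]
        by simp
      then have "sin (slot_defect y ?s) \<le> sin (slot_defect y (opp ?s))"
        using K_pos[of t0] by simp
      moreover have "sin (slot_defect y (opp ?s)) < sin (pi - slot_defect y ?s)"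
        using \<open>\<not> slot_defect y ?s < pi / 2\<close> defect_add[of ?s] theta_less_pi[of ?s] defect[of ?s] defect[of "opp ?s"]
        by (intro sin_monotone_2pi) auto
      ultimately show False by simp
    qed
    have "0 < cot (slot_defect y (t0, i))" for i
      using half[of i] defect[of "(t0, i)"] unfolding cot_def by (intro divide_pos_pos cos_gt_zero sin_pos)
    then have pos: "0 < cot (side_defect (y t0) i)" for i by (simp add: slot_defect_def)
    have "sin (side_defect (y t0) i) \<noteq> 0" for i
      using sin_pos[of "(t0, i)"] by (simp add: slot_defect_def)
    then have "(K t0)\<^sup>2 < 1"
      using circum_sq_cot[of "side_defect (y t0)" 1] mult_pos_pos[OF pos[of 1] pos[of 2]]
        mult_pos_pos[OF pos[of 2] pos[of 3]] mult_pos_pos[OF pos[of 3] pos[of 1]]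
      by (simp add: K_sq)
    then have "K t0 < 1" using K_pos[of t0] by (simp add: power_less_one_iff)
    then show ?thesis using K_max[of t] by simp
  qed
  have "\<exists>T. 0 < T \<and> T < 1 \<and> circum_of T = K t" for t
    using circum_of_surj[OF K_pos K_less] by metis
  then obtain T where T: "\<And>t. 0 < T t" "\<And>t. T t < 1" "\<And>t. circum_of (T t) = K t"
    by metis
  have cot: "cot (slot_defect y s) = base_cot (\<theta> s) (T (fst s)) (T (fst (opp s)))" for s
  proof (subst base_cot_eq_iff)
    have "slot_defect y (opp s) = \<theta> s - slot_defect y s" using defect_add[of s] by simp
    then show "circum_of (T (fst s)) * sin (slot_defect y s) = circum_of (T (fst (opp s))) * sin (\<theta> s - slot_defect y s)"
      using K_eq[of s] by (simp add: T)
  qed (simp_all add: T defect theta_pos theta_less_pi)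
  moreover have "half_cone T t = pi" for t
  proof -
    \<comment> \<open>This is 1 / cosh of the circumradius, while \<open>K t\<close> is its
      tanh.\<close>
    define w where "w = (1 - (T t)\<^sup>2) / (1 + (T t)\<^sup>2)"
    have "(T t)\<^sup>2 < 1" using T(1,2)[of t] by (simp add: power_less_one_iff)
    moreover have "0 < 1 + (T t)\<^sup>2" by (auto intro: add_pos_nonneg)
    ultimately have w: "0 < w" "w \<le> 1" by (auto simp: w_def)
    have "(\<Sum>i\<in>UNIV. acot (cot (side_defect (y t) i) / w)) = pi"
    proof (rule sum_acot_eq_pi[OF _ _ w])
      show "0 < side_defect (y t) i" for i using defect(1)[of "(t, i)"] by (simp add: slot_defect_def)
      show "side_defect (y t) (i + 1) + side_defect (y t) (i + 2) < pi" for i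
        using angle_eq_side_defect[of "y t" i] y[of t i] by simp
      show "w\<^sup>2 = 1 - circum_sq (side_defect (y t))"
        using circum_of_sq[of "T t"] by (simp add: w_def T(3) K_sq)
    qed
    moreover have "slot_angle T (t, i) = acot (cot (side_defect (y t) i) / w)" for i
      using cot[of "(t, i)"] by (simp add: slot_angle_def centre_angle_def w_def slot_defect_def mult.commute)
    ultimately show ?thesis by (simp add: half_cone_def)
  qed
  ultimately show ?thesis using that T by blast
qed

text \<open>The radii prescribe the defects through \<open>base_cot\<close>, and these the angles.
  \<open>scaled_cot_triangle\<close> makes every triangle hyperbolic, and
  \<open>base_cot_eq_iff\<close> makes the side lengths agree.\<close>

lemma uniform_of_solution:
  assumes T: "\<And>t. 0 < T t" "\<And>t. T t < 1" "\<And>t. half_cone T t = pi"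
  shows "\<exists>y. uniform \<phi> y \<and> conformally_equivalent \<phi> x y"
proof -
  define \<psi> where "\<psi> t i = acot (base_cot (\<theta> (t, i)) (T t) (T (fst (opp (t, i)))))" for t i
  define y where "y t i = pi - \<psi> t (i + 1) - \<psi> t (i + 2)" for t i
  define w where "w t = (1 - (T t)\<^sup>2) / (1 + (T t)\<^sup>2)" for t
  have "(T t)\<^sup>2 < 1" for t using T(1,2)[of t] by (simp add: power_less_one_iff)
  moreover have pos: "0 < 1 + (T t)\<^sup>2" "0 < (T t)\<^sup>2" for t using T(1)[of t] by (auto intro: add_pos_nonneg)
  ultimately have w: "0 < w t" "w t < 1" for t by (auto simp: w_def)
  have defect: "side_defect (y t) i = \<psi> t i" for t i
    by (rule side_defect_of_angles) (simp add: y_def)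
  have triangle: "\<psi> t (i + 1) + \<psi> t (i + 2) < pi" "pi < (\<Sum>i\<in>UNIV. \<psi> t i)" "circum_sq (\<psi> t) = 1 - (w t)\<^sup>2" for t i
  proof -
    have "\<psi> t i = acot (w t * cot (slot_angle T (t, i)))" for i
      using w(1)[of t] pos(1)[of t] \<open>(T t)\<^sup>2 < 1\<close>
      by (simp add: \<psi>_def slot_angle_def centre_angle_def w_def)
    moreover have "0 < slot_angle T (t, i)" for i
      by (simp add: slot_angle_def centre_angle_def acot_bounds)
    moreover have "(\<Sum>i\<in>UNIV. slot_angle T (t, i)) = pi"
      using T(3)[of t] by (simp add: half_cone_def)
    ultimately show "\<psi> t (i + 1) + \<psi> t (i + 2) < pi" "pi < (\<Sum>i\<in>UNIV. \<psi> t i)" "circum_sq (\<psi> t) = 1 - (w t)\<^sup>2"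
      using scaled_cot_triangle[of "\<lambda>i. slot_angle T (t, i)" "w t" "\<psi> t"] w by blast+
  qed
  have \<psi>_bounds: "0 < \<psi> t i" "\<psi> t i < pi" for t i by (simp_all add: \<psi>_def acot_bounds)
  have y: "0 < y t i" "y t i < pi" for t i
    using triangle(1)[of t i] \<psi>_bounds(1)[of t "i + 1"] \<psi>_bounds(1)[of t "i + 2"] by (simp_all add: y_def)
  have sum: "(\<Sum>i\<in>UNIV. y t i) < pi" for t
    using sum_side_defect[of "y t"] triangle(2)[of t] by (simp add: defect)
  have "slot_defect y s + slot_defect y (opp s) = \<theta> s" for s
    using acot_base_cot_add[of "T (fst s)" "T (fst (opp s))" "\<theta> s"] T theta_pos[of s] theta_less_pi[of s]
    by (simp add: slot_defect_def defect \<psi>_def)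
  then have conf: "conformally_equivalent \<phi> x y"
    using y by (simp add: conformally_equivalent_iff)
  have "\<exists>P. hyp_triangle P \<and> (\<forall>i. corner_angle P i = y t i)" for t
    using hyp_triangle_exists[of "y t"] y sum by metis
  then obtain P where P: "\<And>t. hyp_triangle (P t)" "\<And>t i. corner_angle (P t) i = y t i"
    by metis
  \<comment> \<open>The squared tanh of half the side length, which determines the length.\<close>
  define h where "h s = (cosh_side (P (fst s)) (snd s) - 1) / (cosh_side (P (fst s)) (snd s) + 1)" for s
  have h: "h s = (circum_of (T (fst s)) * sin (\<psi> (fst s) (snd s)))\<^sup>2" for s
    unfolding h_def using cosh_side_circum[OF P(1,2) y(1) sum, of "fst s" "snd s"]
    by (simp add: defect[abs_def] triangle(3) circum_of_sq power_mult_distrib flip: w_def)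
  have h_opp: "h (opp s) = h s" for s
  proof -
    have "\<psi> (fst (opp s)) (snd (opp s)) = \<theta> s - \<psi> (fst s) (snd s)"
      using acot_base_cot_add[of "T (fst s)" "T (fst (opp s))" "\<theta> s"] T theta_pos[of s] theta_less_pi[of s]
      by (simp add: \<psi>_def)
    moreover have "circum_of (T (fst s)) * sin (\<psi> (fst s) (snd s)) =
        circum_of (T (fst (opp s))) * sin (\<theta> s - \<psi> (fst s) (snd s))"
      using T theta_pos[of s] theta_less_pi[of s] \<psi>_bounds[of "fst s" "snd s"]
      by (subst base_cot_eq_iff[symmetric]) (simp_all add: \<psi>_def)
    ultimately show ?thesis by (simp add: h)
  qed
  have side: "side_length (P t) i = side_length (P t') i'" if "edge \<phi> t i = edge \<phi> t' i'" for t i t' i'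
  proof -
    have "slot_edge \<phi> (t', i') = slot_edge \<phi> (t, i)" using that by (simp add: slot_edge_def)
    then have "h (t', i') = h (t, i)"
      using slot_edge_eq_iff[OF tri, of "(t', i')" "(t, i)"] h_opp[of "(t, i)"] by auto
    moreover have "1 < cosh_side (P t) i" "1 < cosh_side (P t') i'" by (simp_all add: cosh_side_gt_1 P)
    ultimately have "cosh_side (P t) i = cosh_side (P t') i'"
      by (simp add: h_def field_simps)
    then show ?thesis by (simp add: side_length_eq_iff P)
  qed
  have "delaunay \<phi> y" using conf by (simp add: conformally_equivalent_def)
  then have "uniform \<phi> y"
    unfolding uniform_def curvature_def using sum P
    by (intro conjI allI exI[of _ P] impI side) simp_all
  then show ?thesis using conf by blast
qed

text \<open>Both systems yield solutions for the radii, which coincide. The radii fix the cotangents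
  of the defects, and the defects fix the angles.\<close>

lemma uniform_unique:
  assumes "uniform \<phi> y" "conformally_equivalent \<phi> x y"
    and "uniform \<phi> z" "conformally_equivalent \<phi> x z"
  shows "y = z"
proof -
  obtain T where T: "\<And>t. 0 < T t" "\<And>t. T t < 1" "\<And>t. half_cone T t = pi"
      "\<And>s. cot (slot_defect y s) = base_cot (\<theta> s) (T (fst s)) (T (fst (opp s)))"
    using solution_of_uniform[OF assms(1,2)] by blast
  obtain U where U: "\<And>t. 0 < U t" "\<And>t. U t < 1" "\<And>t. half_cone U t = pi"
      "\<And>s. cot (slot_defect z s) = base_cot (\<theta> s) (U (fst s)) (U (fst (opp s)))"
    using solution_of_uniform[OF assms(3,4)] by blast
  have "T = U" by (rule half_cone_solution_unique) (fact T U)+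
  have acot_defect: "acot (cot (slot_defect u s)) = slot_defect u s" if "uniform \<phi> u" for u s
  proof (rule acot_cot)
    have "0 < u t i" "(\<Sum>i\<in>UNIV. u t i) < pi" for t i
      using that by (auto simp: uniform_def delaunay_def curvature_def)
    then show "0 < slot_defect u s" "slot_defect u s < pi"
      unfolding slot_defect_def by (intro side_defect_bounds; simp)+
  qed
  have "slot_defect y s = slot_defect z s" for s
    using acot_defect[OF assms(1), of s] acot_defect[OF assms(3), of s] T(4)[of s] U(4)[of s] \<open>T = U\<close> by simp
  then have defect: "side_defect (y t) i = side_defect (z t) i" for t i
    unfolding slot_defect_def by (metis fst_conv snd_conv)
  have "y t i = z t i" for t i
    using angle_eq_side_defect[of "y t" i] angle_eq_side_defect[of "z t" i] by (simp add: defect)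
  then show ?thesis by (intro ext)
qed

end

theorem theorem3:
  fixes M :: "'a topology"
    and \<phi> :: "'t::finite \<Rightarrow> real ^ 3 \<Rightarrow> 'a"
    and x :: "'t \<Rightarrow> 3 \<Rightarrow> real"
  assumes "closed_surface M"
    and "surface_euler_characteristic M < 0"
    and "topological_triangulation M \<phi>"
    and "delaunay \<phi> x"
    and "\<And>S :: 't set. S \<noteq> {} \<Longrightarrow> (\<Sum>e\<in>edges_of \<phi> S. theta \<phi> x e) > pi * real (card S)"
  shows "\<exists>!y. uniform \<phi> y \<and> conformally_equivalent \<phi> x y"
proof -
  interpret delaunay_surface M \<phi> x using assms(3,4) by unfold_locales
  obtain T where "\<And>t. 0 < T t" "\<And>t. T t < 1" "\<And>t. half_cone T t = pi"
    using half_cone_solution_exists assms(5) unfolding sum_theta_edges_of by blast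
  then show ?thesis using uniform_of_solution uniform_unique by blast
qed

end
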